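(* The symmetry group $\operatorname{Sym}_{(3,3,4)}(B)=(\mathcal{Q}_B^1/\{\pm1\})/B$ is isomorphic to $SL_2(\mathbb{F}_3)$.
   Context: $K=\mathbb{Q}(\sqrt2)$, $O_K=\mathbb{Z}[\sqrt2]$. $D_B$ is the quaternion algebra over $K$ with basis $1,i,j,ij$ and relations $i^2=-3$, $j^2=\sqrt2$, $ji=-ij$. Put $\alpha=\frac12(1+i)$, $\beta=\frac16\bigl(3+(1+2\sqrt2)i-2ij\bigr)$, and let $\mathcal{Q}_B=O_K[\alpha,\beta]$ be the $O_K$-subalgebra of $D_B$ generated by $\alpha,\beta$ (a maximal order). $\mathcal{Q}_B^1$ is the group of elements of reduced norm $1$ in $\mathcal{Q}_B$. The Bolza group $B$ is the normal subgroup of $\mathcal{Q}_B^1/\{\pm1\}$ generated, as a normal subgroup, by the image of $(\alpha\beta)^2(\alpha^2\beta^2)^2$. *)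

theory Defs
  imports
    "HOL-Analysis.Determinants"
    "HOL-Library.Numeral_Type"
    "HOL-Algebra.Generated_Rings"
    "HOL-Algebra.Coset"
begin

text \<open>\<open>Quat x y z w\<close> stands for \<open>x + y i + z j + w ij\<close>.\<close>

datatype 'a quat = Quat (q1: 'a) (qi: 'a) (qj: 'a) (qij: 'a)

text \<open>
  The quaternion algebra with \<open>i\<^sup>2 = a\<close>, \<open>j\<^sup>2 = b\<close>, \<open>ji = -ij\<close> over a subfield \<open>F\<close> of the
  type \<open>'a\<close>; the field enters only through the carrier.
\<close>

definition quat_mult :: "'a::field \<Rightarrow> 'a \<Rightarrow> 'a quat \<Rightarrow> 'a quat \<Rightarrow> 'a quat" where
  "quat_mult a b x y = Quat
     (q1 x * q1 y + a * (qi x * qi y) + b * (qj x * qj y) - a * b * (qij x * qij y))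
     (q1 x * qi y + qi x * q1 y - b * (qj x * qij y) + b * (qij x * qj y))
     (q1 x * qj y + qj x * q1 y + a * (qi x * qij y) - a * (qij x * qi y))
     (q1 x * qij y + qij x * q1 y + qi x * qj y - qj x * qi y)"

definition quat_add :: "'a::field quat \<Rightarrow> 'a quat \<Rightarrow> 'a quat" where
  "quat_add x y = Quat (q1 x + q1 y) (qi x + qi y) (qj x + qj y) (qij x + qij y)"

definition quat_of :: "'a::field \<Rightarrow> 'a quat" where
  "quat_of c = Quat c 0 0 0"

definition quaternion_algebra :: "'a::field set \<Rightarrow> 'a \<Rightarrow> 'a \<Rightarrow> 'a quat ring" where
  "quaternion_algebra F a b =
     \<lparr>carrier = {x. {q1 x, qi x, qj x, qij x} \<subseteq> F},
      monoid.mult = quat_mult a b, one = quat_of 1, zero = quat_of 0, add = quat_add\<rparr>"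

definition quat_cnj :: "'a::field quat \<Rightarrow> 'a quat" where
  "quat_cnj x = Quat (q1 x) (- qi x) (- qj x) (- qij x)"

definition reduced_norm :: "'a::field \<Rightarrow> 'a \<Rightarrow> 'a quat \<Rightarrow> 'a" where
  "reduced_norm a b x = (q1 x)\<^sup>2 - a * (qi x)\<^sup>2 - b * (qj x)\<^sup>2 + a * b * (qij x)\<^sup>2"

lemma quat_mult_cnj:
  "quat_mult a b x (quat_cnj x) = quat_of (reduced_norm a b x)"
  "quat_mult a b (quat_cnj x) x = quat_of (reduced_norm a b x)"
  by (simp_all add: quat_mult_def quat_cnj_def quat_of_def reduced_norm_def
      power2_eq_square algebra_simps)

lemma reduced_norm_mult:
  "reduced_norm a b (quat_mult a b x y) = reduced_norm a b x * reduced_norm a b y"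
  by (simp add: quat_mult_def reduced_norm_def power2_eq_square algebra_simps)

lemma quat_relations:
  defines "I \<equiv> Quat 0 1 0 0" and "J \<equiv> Quat 0 0 1 0"
  shows "quat_mult a b I I = quat_of a" "quat_mult a b J J = quat_of b"
    "quat_mult a b I J = Quat 0 0 0 1" "quat_mult a b J I = Quat 0 0 0 (-1)"
  by (simp_all add: I_def J_def quat_mult_def quat_of_def)

definition K :: "real set" where
  "K = {x + y * sqrt 2 | x y. x \<in> \<rat> \<and> y \<in> \<rat>}"

definition O_K :: "real set" where
  "O_K = {x + y * sqrt 2 | x y. x \<in> \<int> \<and> y \<in> \<int>}"

lemma K_memI: "x \<in> \<rat> \<Longrightarrow> y \<in> \<rat> \<Longrightarrow> z = x + y * sqrt 2 \<Longrightarrow> z \<in> K"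
  unfolding K_def by blast

lemma K_uminus: "x \<in> K \<Longrightarrow> - x \<in> K"
proof -
  assume "x \<in> K"
  then obtain a b where "x = a + b * sqrt 2" "a \<in> \<rat>" "b \<in> \<rat>"
    unfolding K_def by blast
  then show "- x \<in> K"
    by (intro K_memI[of "- a" "- b"]) simp_all
qed

lemma K_add: "x \<in> K \<Longrightarrow> y \<in> K \<Longrightarrow> x + y \<in> K"
proof -
  assume "x \<in> K" "y \<in> K"
  then obtain a b c d where "x = a + b * sqrt 2" "y = c + d * sqrt 2"
    "a \<in> \<rat>" "b \<in> \<rat>" "c \<in> \<rat>" "d \<in> \<rat>"
    unfolding K_def by blast
  then show "x + y \<in> K"
    by (intro K_memI[of "a + c" "b + d"]) (simp_all add: algebra_simps)
qed

lemma K_mult: "x \<in> K \<Longrightarrow> y \<in> K \<Longrightarrow> x * y \<in> K"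
proof -
  assume "x \<in> K" "y \<in> K"
  then obtain a b c d where "x = a + b * sqrt 2" "y = c + d * sqrt 2"
    "a \<in> \<rat>" "b \<in> \<rat>" "c \<in> \<rat>" "d \<in> \<rat>"
    unfolding K_def by blast
  then show "x * y \<in> K"
    by (intro K_memI[of "a * c + 2 * (b * d)" "a * d + b * c"]) (simp_all add: algebra_simps)
qed

lemma K_diff: "x \<in> K \<Longrightarrow> y \<in> K \<Longrightarrow> x - y \<in> K"
  using K_add[of x "- y"] K_uminus[of y] by simp

lemmas K_closed = K_add K_mult K_uminus K_diff

lemma Rats_subset_K: "x \<in> \<rat> \<Longrightarrow> x \<in> K"
  unfolding K_def by (rule CollectI, rule exI[of _ x], rule exI[of _ 0]) simp

lemma sqrt2_in_K: "sqrt 2 \<in> K"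
  unfolding K_def by (rule CollectI, rule exI[of _ 0], rule exI[of _ 1]) simp

lemma O_K_subset_K: "O_K \<subseteq> K"
  unfolding O_K_def K_def using Ints_subset_Rats by blast

definition D_B :: "real quat ring" where
  "D_B = quaternion_algebra K (-3) (sqrt 2)"

lemma D_B_ring: "ring D_B"
proof -
  note defs = D_B_def quaternion_algebra_def quat_mult_def quat_add_def quat_of_def
  have c: "0 \<in> K" "1 \<in> K" "3 \<in> K" by (simp_all add: Rats_subset_K)
  show ?thesis
  proof (rule ringI)
    show "abelian_group D_B"
    proof (rule abelian_groupI)
      fix x assume x: "x \<in> carrier D_B"
      have "Quat (- q1 x) (- qi x) (- qj x) (- qij x) \<in> carrier D_B"
        using x by (auto simp: defs K_closed)
      then show "\<exists>y\<in>carrier D_B. y \<oplus>\<^bsub>D_B\<^esub> x = \<zero>\<^bsub>D_B\<^esub>"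
        by (rule rev_bexI) (simp add: defs)
    qed (auto simp: defs K_closed c)
    show "Group.monoid D_B"
      by (rule monoidI)
        (auto simp: defs K_closed c sqrt2_in_K algebra_simps
          intro!: K_closed)
  qed (auto simp: defs algebra_simps)
qed

definition \<alpha> :: "real quat" where
  "\<alpha> = Quat (1/2) (1/2) 0 0"

definition \<beta> :: "real quat" where
  "\<beta> = Quat (3/6) ((1 + 2 * sqrt 2) / 6) 0 (-2/6)"

definition Q_B :: "real quat set" where
  "Q_B = generate_ring D_B (quat_of ` O_K \<union> {\<alpha>, \<beta>})"

lemma gens_in_D_B: "quat_of ` O_K \<union> {\<alpha>, \<beta>} \<subseteq> carrier D_B"
proof -
  have "(1 + 2 * sqrt 2) / 6 = 1/6 + (1/3) * sqrt 2" by simp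
  then have "(1 + 2 * sqrt 2) / 6 \<in> K"
    by (metis K_closed(1,2) Rats_1 Rats_divide Rats_number_of Rats_subset_K sqrt2_in_K)
  moreover have "\<And>x. x \<in> O_K \<Longrightarrow> x \<in> K" using O_K_subset_K by blast
  moreover have "1/2 \<in> K" "-(1/3) \<in> K" "0 \<in> K"
    by (intro Rats_subset_K, simp)+
  ultimately show ?thesis
    by (auto simp: \<alpha>_def \<beta>_def D_B_def quaternion_algebra_def quat_of_def)
qed

lemma Q_B_subring: "subring Q_B D_B"
  unfolding Q_B_def by (rule ring.generate_ring_is_subring[OF D_B_ring gens_in_D_B])

definition Q_B1 :: "real quat monoid" where
  "Q_B1 = \<lparr>carrier = {x \<in> Q_B. reduced_norm (-3) (sqrt 2) x = 1},
           monoid.mult = monoid.mult D_B, one = one D_B\<rparr>"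

lemma Q_B_cnj: "x \<in> Q_B \<Longrightarrow> quat_cnj x \<in> Q_B"
  unfolding Q_B_def
proof (induction rule: generate_ring.induct)
  case one
  have "quat_cnj \<one>\<^bsub>D_B\<^esub> = \<one>\<^bsub>D_B\<^esub>"
    by (simp add: quat_cnj_def D_B_def quaternion_algebra_def quat_of_def)
  then show ?case by (simp add: generate_ring.one)
next
  case (incl h)
  let ?G = "generate_ring D_B (quat_of ` O_K \<union> {\<alpha>, \<beta>})"
  have one_minus: "quat_cnj h \<in> ?G" if h: "h \<in> {\<alpha>, \<beta>}"
  proof -
    interpret ring D_B by (rule D_B_ring)
    have hG: "h \<in> ?G" using h by (auto intro: generate_ring.incl)
    have hc: "h \<in> carrier D_B" "quat_cnj h \<in> carrier D_B"
      using h gens_in_D_B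
      by (auto simp: D_B_def quaternion_algebra_def quat_cnj_def K_closed)
    have "quat_cnj h \<oplus>\<^bsub>D_B\<^esub> h = \<one>\<^bsub>D_B\<^esub>"
      using h by (auto simp: \<alpha>_def \<beta>_def quat_cnj_def quat_add_def D_B_def
          quaternion_algebra_def quat_of_def)
    then have "quat_cnj h = \<one>\<^bsub>D_B\<^esub> \<oplus>\<^bsub>D_B\<^esub> (\<ominus>\<^bsub>D_B\<^esub> h)"
      using hc by (metis minus_closed minus_eq r_neg a_assoc r_zero a_inv_closed)
    moreover have "\<one>\<^bsub>D_B\<^esub> \<oplus>\<^bsub>D_B\<^esub> (\<ominus>\<^bsub>D_B\<^esub> h) \<in> ?G"
      by (intro generate_ring.eng_add generate_ring.one generate_ring.a_inv hG)
    ultimately show ?thesis by (rule ssubst)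
  qed
  show ?case
  proof (cases "h \<in> {\<alpha>, \<beta>}")
    case False
    then have "quat_cnj h = h" using incl by (auto simp: quat_cnj_def quat_of_def)
    then show ?thesis using incl by (metis generate_ring.incl)
  qed (rule one_minus)
next
  case (a_inv h)
  interpret ring D_B by (rule D_B_ring)
  have h: "h \<in> carrier D_B" using a_inv.hyps generate_ring_in_carrier[OF gens_in_D_B] by blast
  then have c: "quat_cnj h \<in> carrier D_B" "quat_cnj (\<ominus>\<^bsub>D_B\<^esub> h) \<in> carrier D_B"
    using a_inv_closed[OF h]
    by (auto simp: D_B_def quaternion_algebra_def quat_cnj_def K_closed)
  have "quat_cnj (\<ominus>\<^bsub>D_B\<^esub> h) \<oplus>\<^bsub>D_B\<^esub> quat_cnj h = quat_cnj (\<ominus>\<^bsub>D_B\<^esub> h \<oplus>\<^bsub>D_B\<^esub> h)"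
    by (simp add: quat_cnj_def quat_add_def D_B_def quaternion_algebra_def)
  also have "\<dots> = \<zero>\<^bsub>D_B\<^esub>"
    unfolding l_neg[OF h]
    by (simp add: quat_cnj_def quat_of_def D_B_def quaternion_algebra_def)
  finally have "quat_cnj (\<ominus>\<^bsub>D_B\<^esub> h) = \<ominus>\<^bsub>D_B\<^esub> quat_cnj h"
    using c by (metis minus_equality)
  then show ?case using a_inv.IH by (simp add: generate_ring.a_inv)
next
  case (eng_add h1 h2)
  have "quat_cnj (h1 \<oplus>\<^bsub>D_B\<^esub> h2) = quat_cnj h1 \<oplus>\<^bsub>D_B\<^esub> quat_cnj h2"
    by (simp add: quat_cnj_def quat_add_def D_B_def quaternion_algebra_def)
  then show ?case using eng_add.IH by (simp add: generate_ring.eng_add)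
next
  case (eng_mult h1 h2)
  have "quat_cnj (h1 \<otimes>\<^bsub>D_B\<^esub> h2) = quat_cnj h2 \<otimes>\<^bsub>D_B\<^esub> quat_cnj h1"
    by (simp add: quat_cnj_def quat_mult_def D_B_def quaternion_algebra_def algebra_simps)
  then show ?case using eng_mult.IH by (simp add: generate_ring.eng_mult)
qed

lemma Q_B1_group: "group Q_B1"
proof -
  interpret ring D_B by (rule D_B_ring)
  interpret S: subring Q_B D_B by (rule Q_B_subring)
  let ?n = "reduced_norm (-3) (sqrt 2)"
  have n1: "?n \<one>\<^bsub>D_B\<^esub> = 1"
    by (simp add: D_B_def quaternion_algebra_def quat_of_def reduced_norm_def)
  have nm: "?n (x \<otimes>\<^bsub>D_B\<^esub> y) = ?n x * ?n y" for x y
    by (simp add: D_B_def quaternion_algebra_def reduced_norm_mult)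
  have sub: "x \<in> carrier D_B" if "x \<in> Q_B" for x
    using that S.subset by blast
  show ?thesis
  proof (rule groupI)
    fix x assume "x \<in> carrier Q_B1"
    then have x: "x \<in> Q_B" "?n x = 1" by (auto simp: Q_B1_def)
    have "quat_cnj x \<otimes>\<^bsub>D_B\<^esub> x = \<one>\<^bsub>D_B\<^esub>"
      using x by (simp add: D_B_def quaternion_algebra_def quat_mult_cnj)
    moreover have "?n (quat_cnj x) = 1"
      using x by (simp add: reduced_norm_def quat_cnj_def)
    ultimately show "\<exists>y\<in>carrier Q_B1. y \<otimes>\<^bsub>Q_B1\<^esub> x = \<one>\<^bsub>Q_B1\<^esub>"
      using Q_B_cnj[OF x(1)] by (auto simp: Q_B1_def)
  qed (auto simp: Q_B1_def n1 nm sub m_assoc)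
qed

text \<open>Here \<open>quat_of (-1)\<close> is \<open>\<ominus>\<^bsub>D_B\<^esub> \<one>\<^bsub>D_B\<^esub>\<close>.\<close>

definition pm1 :: "real quat set" where
  "pm1 = {quat_of 1, quat_of (-1)}"

lemma pm1_normal: "pm1 \<lhd> Q_B1"
proof -
  interpret R: ring D_B by (rule D_B_ring)
  interpret S: subring Q_B D_B by (rule Q_B_subring)
  interpret group Q_B1 by (rule Q_B1_group)
  have "z \<in> O_K" if "z \<in> \<int>" for z
    unfolding O_K_def using that by (intro CollectI exI[of _ z] exI[of _ 0]) simp
  then have "quat_of 1 \<in> Q_B" "quat_of (-1) \<in> Q_B"
    unfolding Q_B_def by (intro generate_ring.incl UnI1 imageI; simp)+
  then have c: "pm1 \<subseteq> carrier Q_B1"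
    by (auto simp: pm1_def Q_B1_def quat_of_def reduced_norm_def)
  have mul: "x \<otimes>\<^bsub>Q_B1\<^esub> y \<in> pm1" if "x \<in> pm1" "y \<in> pm1" for x y
    using that by (auto simp: pm1_def Q_B1_def D_B_def quaternion_algebra_def quat_mult_def quat_of_def)
  have sq: "x \<otimes>\<^bsub>Q_B1\<^esub> x = \<one>\<^bsub>Q_B1\<^esub>" if "x \<in> pm1" for x
    using that by (auto simp: pm1_def Q_B1_def D_B_def quaternion_algebra_def quat_mult_def quat_of_def)
  have inv: "inv\<^bsub>Q_B1\<^esub> x = x" if "x \<in> pm1" for x
    using that c sq by (intro inv_equality) auto
  have comm: "x \<otimes>\<^bsub>Q_B1\<^esub> h = h \<otimes>\<^bsub>Q_B1\<^esub> x" if "h \<in> pm1" for x h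
    using that by (auto simp: pm1_def Q_B1_def D_B_def quaternion_algebra_def quat_mult_def quat_of_def)
  have sg: "subgroup pm1 Q_B1"
  proof (rule subgroupI)
    show "pm1 \<subseteq> carrier Q_B1" by (rule c)
    show "pm1 \<noteq> {}" by (simp add: pm1_def)
    show "inv\<^bsub>Q_B1\<^esub> x \<in> pm1" if "x \<in> pm1" for x using that inv by simp
  qed (rule mul)
  show ?thesis
  proof (rule normal_invI[OF sg])
    fix x h assume x: "x \<in> carrier Q_B1" and h: "h \<in> pm1"
    then have hc: "h \<in> carrier Q_B1" using c by blast
    have "x \<otimes>\<^bsub>Q_B1\<^esub> h \<otimes>\<^bsub>Q_B1\<^esub> inv\<^bsub>Q_B1\<^esub> x = h"
      unfolding comm[OF h] using x hc by (simp add: m_assoc)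
    then show "x \<otimes>\<^bsub>Q_B1\<^esub> h \<otimes>\<^bsub>Q_B1\<^esub> inv\<^bsub>Q_B1\<^esub> x \<in> pm1" using h by simp
  qed
qed

definition normal_closure :: "('a, 'b) monoid_scheme \<Rightarrow> 'a set \<Rightarrow> 'a set" where
  "normal_closure G S = \<Inter>{N. N \<lhd> G \<and> S \<subseteq> N}"

lemma normal_closure_normal:
  assumes "group G" "S \<subseteq> carrier G"
  shows "normal_closure G S \<lhd> G" "S \<subseteq> normal_closure G S"
proof -
  interpret group G by fact
  let ?F = "{N. N \<lhd> G \<and> S \<subseteq> N}"
  have ne: "carrier G \<in> ?F"
    using assms(2) by (auto intro!: normal_invI subgroup_self)
  have "subgroup (\<Inter>?F) G"
    using ne by (intro subgroups_Inter) (auto dest: normal_imp_subgroup)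
  then show "normal_closure G S \<lhd> G"
    unfolding normal_closure_def
    by (rule normal_invI) (auto intro: normal.inv_op_closed2)
  show "S \<subseteq> normal_closure G S"
    by (auto simp: normal_closure_def)
qed

definition bolza_word :: "real quat" where
  "bolza_word =
     (\<alpha> \<otimes>\<^bsub>D_B\<^esub> \<beta>) [^]\<^bsub>D_B\<^esub> (2::nat) \<otimes>\<^bsub>D_B\<^esub>
     (\<alpha> [^]\<^bsub>D_B\<^esub> (2::nat) \<otimes>\<^bsub>D_B\<^esub> \<beta> [^]\<^bsub>D_B\<^esub> (2::nat)) [^]\<^bsub>D_B\<^esub> (2::nat)"

text \<open>Elements of \<open>Q_B1 Mod pm1\<close> are cosets; \<open>pm1 #>\<^bsub>Q_B1\<^esub> x\<close> is the image of \<open>x\<close>.\<close>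

definition bolza_group :: "real quat set set" where
  "bolza_group = normal_closure (Q_B1 Mod pm1) {pm1 #>\<^bsub>Q_B1\<^esub> bolza_word}"

lemma bolza_word_in_Q_B1: "bolza_word \<in> carrier Q_B1"
proof -
  interpret R: ring D_B by (rule D_B_ring)
  interpret group Q_B1 by (rule Q_B1_group)
  have g: "\<alpha> \<in> carrier Q_B1" "\<beta> \<in> carrier Q_B1"
    by (auto simp: Q_B1_def Q_B_def intro: generate_ring.incl)
       (simp_all add: \<alpha>_def \<beta>_def reduced_norm_def power2_eq_square field_simps)
  have m: "x \<otimes>\<^bsub>D_B\<^esub> y \<in> carrier Q_B1" if "x \<in> carrier Q_B1" "y \<in> carrier Q_B1" for x y
    using m_closed[OF that] by (simp add: Q_B1_def)
  have p: "x [^]\<^bsub>D_B\<^esub> (2::nat) \<in> carrier Q_B1" if "x \<in> carrier Q_B1" for x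
  proof -
    have "x \<in> carrier D_B"
      using that subringE(1)[OF Q_B_subring] by (auto simp: Q_B1_def)
    then have "x [^]\<^bsub>D_B\<^esub> (2::nat) = x \<otimes>\<^bsub>D_B\<^esub> x"
      by (simp add: numeral_2_eq_2)
    then show ?thesis using m that by simp
  qed
  show ?thesis unfolding bolza_word_def by (intro m p g)
qed

lemma bolza_group_normal: "bolza_group \<lhd> Q_B1 Mod pm1"
proof -
  interpret normal pm1 Q_B1 by (rule pm1_normal)
  show ?thesis unfolding bolza_group_def
    by (rule normal_closure_normal[OF factorgroup_is_group])
      (use bolza_word_in_Q_B1 in \<open>auto simp: FactGroup_def RCOSETS_def\<close>)
qed

definition Sym_334 :: "real quat set set \<Rightarrow> real quat set set monoid" where
  "Sym_334 N = (Q_B1 Mod pm1) Mod N"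

text \<open>The numeral type \<open>3\<close> is the ring of integers modulo 3, i.e. the field with three elements.\<close>

definition SL2_F3 :: "(3^2^2) monoid" where
  "SL2_F3 = \<lparr>carrier = {A. det A = 1}, monoid.mult = (**), one = mat 1\<rparr>"

end

theory Submission
  imports Defs "HOL-Algebra.Multiplicative_Group"
begin

text \<open>
  Both groups are generated by two elements \<open>a\<close>, \<open>b\<close> with \<open>a\<^sup>3 = b\<^sup>3 = (ab)\<^sup>4 = 1\<close> and \<open>(ab)\<^sup>2 = (ba)\<^sup>2\<close>, and
  with \<open>(ab)\<^sup>2 \<noteq> 1\<close>. These conditions determine a group up to isomorphism
  (\<open>bolza_pairs_isomorphic\<close>): the element \<open>(ab)\<^sup>2\<close> is central of order 2, the conjugates of \<open>ab\<close> under
  \<open>a\<close> generate a quaternion group of order 8, and \<open>a\<close> acts on it with order 3, so that the group has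
  exactly 24 elements. In \<open>SL\<^sub>2(F\<^sub>3)\<close> the two elementary matrices are such a pair.

  For the quotient of the norm one group, take the images of \<open>\<alpha>\<close> and \<open>\<beta>\<close>. The relations are short
  computations, the Bolza word being the relation \<open>(ab)\<^sup>2 = (ba)\<^sup>2\<close>. Two facts remain.

  First, \<open>\<alpha>\<close> and \<open>\<beta>\<close> generate the norm one group (\<open>Q_B1_generated\<close>). Acting on the hyperbolic plane
  it is a (3,3,4) triangle group, in which \<open>\<alpha>\<close> is a rotation by a third of a full turn about a base
  point and \<open>\<beta>\<close> such a rotation about another vertex. Writing \<open>x = u + v j\<close> with \<open>u\<close>, \<open>v\<close> in
  \<open>K(i)\<close>, the quantity \<open>\<bar>v\<bar>\<^sup>2\<close> measures how far \<open>x\<close> moves the base point. Unless it is small, left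
  multiplication by a power of \<open>\<alpha>\<close> and then by \<open>\<beta>\<close> or its inverse lowers it by a fixed amount (\<open>descent\<close>).
  It cannot be small without vanishing (\<open>height_gap\<close>): \<open>3\<bar>v\<bar>\<^sup>2\<close> is an element of \<open>O_K\<close> whose Galois
  conjugate is bounded, the norm form being definite at the second real place. Where it vanishes,
  \<open>x\<close> is a power of \<open>\<alpha>\<close>.

  Second, the image of \<open>(\<alpha>\<beta>)\<^sup>2\<close> is not trivial (\<open>kernel_to_Sym\<close>). The algebra ramifies at the prime \<open>sqrt 2\<close>,
  and \<open>-1\<close> and the Bolza word are both congruent to 1 modulo the third power of the two-sided prime
  ideal above it. Congruence to 1 modulo that power defines a normal subgroup, so the kernel
  is contained in it, whereas \<open>(\<alpha>\<beta>)\<^sup>2\<close> is not.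
\<close>

section \<open>Groups of order 24 generated by a Bolza pair\<close>

text \<open>
  A (3,3,4)-generated group in which the word \<open>(ab)\<^sup>2 (a\<^sup>2 b\<^sup>2)\<^sup>2\<close> is trivial. Since
  \<open>a\<^sup>3 = b\<^sup>3 = 1\<close>, one has \<open>a\<^sup>2 b\<^sup>2 = (ba)^{-1}\<close>, so that relation is \<open>(ab)\<^sup>2 = (ba)\<^sup>2\<close>, the form
  which makes \<open>(ab)\<^sup>2\<close> visibly central.
\<close>

locale bolza_pair = group G for G (structure) +
  fixes a b
  assumes a_carrier [simp, intro]: "a \<in> carrier G" and b_carrier [simp, intro]: "b \<in> carrier G"
    and a_cubed: "a \<otimes> (a \<otimes> a) = \<one>" and b_cubed: "b \<otimes> (b \<otimes> b) = \<one>"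
    and ab_fourth: "a \<otimes> b \<otimes> (a \<otimes> b) \<otimes> (a \<otimes> b \<otimes> (a \<otimes> b)) = \<one>"
    and ab_squared: "a \<otimes> b \<otimes> (a \<otimes> b) = b \<otimes> a \<otimes> (b \<otimes> a)"
    and generated: "carrier G = generate G {a, b}"
begin

definition c where "c = a \<otimes> b"
definition d where "d = b \<otimes> a"
definition z where "z = c \<otimes> c"

lemma cdz_carrier [simp, intro]: "c \<in> carrier G" "d \<in> carrier G" "z \<in> carrier G"
  by (auto simp: c_def d_def z_def)

lemma z_squared: "z \<otimes> z = \<one>"
  using ab_fourth by (simp add: z_def c_def)

lemma d_squared: "d \<otimes> d = z"
  using ab_squared by (simp add: z_def c_def d_def)

lemma a_z: "a \<otimes> z = z \<otimes> a"
proof -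
  have "a \<otimes> z = a \<otimes> (d \<otimes> d)" by (simp add: d_squared)
  also have "\<dots> = z \<otimes> a" by (simp add: z_def c_def d_def m_assoc)
  finally show ?thesis .
qed

lemma c_z: "c \<otimes> z = z \<otimes> c"
  by (simp add: z_def m_assoc)

lemma d_z: "d \<otimes> z = z \<otimes> d"
  unfolding d_squared [symmetric] by (simp add: m_assoc)

lemma assoc_rule:
  assumes "x \<otimes> y = w" "x \<in> carrier G" "y \<in> carrier G" "u \<in> carrier G"
  shows "x \<otimes> (y \<otimes> u) = w \<otimes> u"
  using assms by (metis m_assoc)

lemma c_a: "c \<otimes> a = a \<otimes> d"
  by (simp add: c_def d_def m_assoc)

text \<open>
  Conjugation by \<open>a\<close> permutes \<open>c = ab\<close>, \<open>d = ba\<close> and a third element \<open>e\<close> cyclically, and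
  \<open>b\<^sup>3 = 1\<close> amounts to \<open>c d e = 1\<close>. The squares of all three equal the central element
  \<open>z\<close>, and \<open>z\<^sup>2 = 1\<close>, so \<open>e = d c\<close>, and \<open>e\<^sup>2 = z\<close> yields the quaternion relation \<open>d c = z c d\<close>.
\<close>

lemma d_a: "d \<otimes> a = a \<otimes> (d \<otimes> c)"
  and d_c: "d \<otimes> c = z \<otimes> (c \<otimes> d)"
proof -
  \<comment> \<open>the conjugate of \<open>d\<close> by \<open>a\<close>, since \<open>a\<^sup>3 = 1\<close>\<close>
  define e where "e = a \<otimes> (a \<otimes> (d \<otimes> a))"
  have e: "e \<in> carrier G" by (simp add: e_def)
  have ae: "a \<otimes> e = d \<otimes> a"
    unfolding e_def using assoc_rule[OF _ _ _ , of a "a \<otimes> a" \<one> "d \<otimes> a"] a_cubed by (simp add: m_assoc)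
  have a3: "a \<otimes> (a \<otimes> (a \<otimes> x)) = x" if "x \<in> carrier G" for x
    using assoc_rule[of a "a \<otimes> a" \<one> x] that a_cubed by (simp add: m_assoc)
  have b3: "b \<otimes> (b \<otimes> (b \<otimes> x)) = x" if "x \<in> carrier G" for x
    using assoc_rule[of b "b \<otimes> b" \<one> x] that b_cubed by (simp add: m_assoc)
  have cde: "c \<otimes> (d \<otimes> e) = \<one>"
    using a_cubed by (simp add: c_def d_def e_def m_assoc a3 b3)
  have dd: "d \<otimes> (d \<otimes> x) = z \<otimes> x" if "x \<in> carrier G" for x
    using assoc_rule[OF d_squared, of x] that by simp
  have cc: "c \<otimes> (c \<otimes> x) = z \<otimes> x" if "x \<in> carrier G" for x
    using assoc_rule[OF z_def[symmetric], of x] that by simp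
  have zz: "z \<otimes> (z \<otimes> x) = x" if "x \<in> carrier G" for x
    using assoc_rule[OF z_squared, of x] that by simp
  have dz: "d \<otimes> (z \<otimes> x) = z \<otimes> (d \<otimes> x)" if "x \<in> carrier G" for x
    using assoc_rule[OF d_z, of x] that by (simp add: m_assoc)
  have cz: "c \<otimes> (z \<otimes> x) = z \<otimes> (c \<otimes> x)" if "x \<in> carrier G" for x
    using assoc_rule[OF c_z, of x] that by (simp add: m_assoc)
  have e_eq: "e = d \<otimes> c"
  proof -
    have "d \<otimes> (c \<otimes> (c \<otimes> (d \<otimes> e))) = d \<otimes> c" using cde e by simp
    then show ?thesis using e by (simp add: cc dz dd zz)
  qed
  show da: "d \<otimes> a = a \<otimes> (d \<otimes> c)" using ae e_eq by simp
  have "a \<otimes> (e \<otimes> e) = a \<otimes> z"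
  proof -
    have "a \<otimes> (e \<otimes> e) = d \<otimes> (a \<otimes> e)" using assoc_rule[OF ae, of e] e by (simp add: m_assoc)
    also have "\<dots> = a \<otimes> z" using ae by (simp add: dd a_z)
    finally show ?thesis .
  qed
  then have ee: "e \<otimes> e = z" using e by simp
  then have "z \<otimes> (c \<otimes> d) = e \<otimes> (e \<otimes> (c \<otimes> d))"
    using assoc_rule[OF ee, of "c \<otimes> d"] e by simp
  also have "\<dots> = d \<otimes> c"
    unfolding e_eq by (simp add: m_assoc cc dd cz dz zz d_squared z_squared)
  finally show "d \<otimes> c = z \<otimes> (c \<otimes> d)" by simp
qed

text \<open>
  A rewriting system for words in \<open>z\<close>, \<open>a\<close>, \<open>c\<close>, \<open>d\<close>: it sorts the letters into this order. The
  copies under \<open>assoc_rule\<close> apply inside words bracketed to the right.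
\<close>

lemmas pair_rules = z_def [symmetric] d_squared z_squared a_z c_z d_z c_a d_a d_c

lemmas pair_rewrites = pair_rules pair_rules [THEN assoc_rule]

text \<open>
  The image of the quaternion group of order 8, normalized by \<open>a\<close>.
\<close>

definition quaternion_part where "quaternion_part = set [\<one>, z, c, z \<otimes> c, d, z \<otimes> d, c \<otimes> d, z \<otimes> (c \<otimes> d)]"

lemma quaternion_part_carrier: "quaternion_part \<subseteq> carrier G"
  by (auto simp: quaternion_part_def)

lemma finite_quaternion_part: "finite quaternion_part"
  by (simp add: quaternion_part_def)

lemma quaternion_part_mult: "x \<in> quaternion_part \<Longrightarrow> y \<in> quaternion_part \<Longrightarrow> x \<otimes> y \<in> quaternion_part"
  by (auto simp: quaternion_part_def m_assoc pair_rewrites)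

lemma quaternion_part_subgroup: "subgroup quaternion_part G"
proof (rule subgroupI)
  show "inv x \<in> quaternion_part" if "x \<in> quaternion_part" for x
  proof -
    have x: "x \<in> carrier G" using that quaternion_part_carrier by blast
    have "x \<otimes> (x \<otimes> (x \<otimes> x)) = \<one>"
      using that by (auto simp: quaternion_part_def m_assoc pair_rewrites)
    then have "inv x = x \<otimes> (x \<otimes> x)"
      using x by (simp add: inv_equality m_assoc)
    then show ?thesis using that quaternion_part_mult by simp
  qed
qed (auto simp: quaternion_part_carrier quaternion_part_mult, simp add: quaternion_part_def)

definition normal_forms where "normal_forms = (\<lambda>(x, q). x \<otimes> q) ` (set [\<one>, a, a \<otimes> a] \<times> quaternion_part)"

lemma normal_forms_I:
  assumes "q \<in> quaternion_part" shows "q \<in> normal_forms" "a \<otimes> q \<in> normal_forms" "a \<otimes> (a \<otimes> q) \<in> normal_forms"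
proof -
  have "q \<in> carrier G" using assms quaternion_part_carrier by blast
  then show "q \<in> normal_forms" "a \<otimes> q \<in> normal_forms" "a \<otimes> (a \<otimes> q) \<in> normal_forms"
    using assms by (force simp: normal_forms_def m_assoc image_iff)+
qed

lemma normal_forms_cases:
  assumes "w \<in> normal_forms"
  obtains q where "q \<in> quaternion_part" "w = q \<or> w = a \<otimes> q \<or> w = a \<otimes> (a \<otimes> q)"
  using assms quaternion_part_carrier by (auto simp: normal_forms_def m_assoc subset_iff)

lemma a_normal_forms: "w \<in> normal_forms \<Longrightarrow> a \<otimes> w \<in> normal_forms"
proof (erule normal_forms_cases)
  fix q assume q: "q \<in> quaternion_part" and w: "w = q \<or> w = a \<otimes> q \<or> w = a \<otimes> (a \<otimes> q)"
  have "q \<in> carrier G" using q quaternion_part_carrier by blast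
  then have "a \<otimes> (a \<otimes> (a \<otimes> q)) = q"
    using assoc_rule[of a "a \<otimes> a" \<one> q] a_cubed by (simp add: m_assoc)
  then show ?thesis using w normal_forms_I[OF q] by auto
qed

lemma c_normal_forms: "w \<in> normal_forms \<Longrightarrow> c \<otimes> w \<in> normal_forms"
proof (erule normal_forms_cases)
  fix q assume q: "q \<in> quaternion_part" and w: "w = q \<or> w = a \<otimes> q \<or> w = a \<otimes> (a \<otimes> q)"
  have qc: "q \<in> carrier G" using q quaternion_part_carrier by blast
  have "c \<in> quaternion_part" "d \<in> quaternion_part" by (simp_all add: quaternion_part_def)
  then have cq: "c \<otimes> q \<in> quaternion_part" "d \<otimes> q \<in> quaternion_part" "d \<otimes> (c \<otimes> q) \<in> quaternion_part"
    using q quaternion_part_mult by auto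
  have "c \<otimes> (a \<otimes> q) = a \<otimes> (d \<otimes> q)"
    using assoc_rule[OF c_a, of q] qc by (simp add: m_assoc)
  moreover have "c \<otimes> (a \<otimes> (a \<otimes> q)) = a \<otimes> (a \<otimes> (d \<otimes> (c \<otimes> q)))"
    using assoc_rule[OF c_a, of "a \<otimes> q"] assoc_rule[OF d_a, of q] qc by (simp add: m_assoc)
  ultimately show ?thesis using w normal_forms_I cq by auto
qed

text \<open>
  Left multiplication by \<open>a\<close> and by \<open>c\<close> preserves the set of products of a power of \<open>a\<close> with an
  element of the quaternion part, because \<open>c\<close> and \<open>d\<close> can be moved past \<open>a\<close>. As
  \<open>b = a\<^sup>2 c\<close>, that set is stable under the whole group and hence equal to it.
\<close>

lemma carrier_eq_normal_forms: "carrier G = normal_forms"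
proof
  show "normal_forms \<subseteq> carrier G" using quaternion_part_carrier by (auto simp: normal_forms_def)
  have b_normal_forms: "b \<otimes> w \<in> normal_forms" if "w \<in> normal_forms" for w
  proof -
    have w: "w \<in> carrier G" using that \<open>normal_forms \<subseteq> carrier G\<close> by blast
    have "b \<otimes> w = a \<otimes> (a \<otimes> (c \<otimes> w))"
      using assoc_rule[of a "a \<otimes> a" \<one> "b \<otimes> w"] a_cubed w by (simp add: c_def m_assoc)
    then show ?thesis using that by (simp add: a_normal_forms c_normal_forms)
  qed
  have inv_eq: "inv a = a \<otimes> a" "inv b = b \<otimes> b"
    using a_cubed b_cubed by (auto intro!: inv_equality simp: m_assoc)
  have gen: "g \<otimes> w \<in> normal_forms" if "g \<in> generate G {a, b}" "w \<in> normal_forms" for g w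
    using that
  proof (induction arbitrary: w rule: generate.induct)
    case one
    then show ?case using \<open>normal_forms \<subseteq> carrier G\<close> by (auto simp: subset_iff)
  next
    case (incl h)
    then show ?case using a_normal_forms b_normal_forms by auto
  next
    case (inv h)
    have "w \<in> carrier G" using inv \<open>normal_forms \<subseteq> carrier G\<close> by blast
    then show ?case using inv a_normal_forms b_normal_forms by (auto simp: inv_eq m_assoc)
  next
    case (eng h1 h2)
    have "w \<in> carrier G" using eng \<open>normal_forms \<subseteq> carrier G\<close> by blast
    moreover have "h1 \<in> carrier G" "h2 \<in> carrier G"
      using eng(1,2) generated by auto
    ultimately show ?case using eng by (simp add: m_assoc)
  qed
  have "\<one> \<in> normal_forms" by (rule normal_forms_I) (simp add: quaternion_part_def)
  then show "carrier G \<subseteq> normal_forms"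
    using gen[of _ \<one>] generated by (metis r_one subsetI)
qed

lemma finite_carrier: "finite (carrier G)"
  by (simp add: carrier_eq_normal_forms normal_forms_def finite_quaternion_part)

lemma card_le_24: "card (carrier G) \<le> 24"
proof -
  have "card (carrier G) \<le> card (set [\<one>, a, a \<otimes> a] \<times> quaternion_part)"
    unfolding carrier_eq_normal_forms normal_forms_def by (rule card_image_le) (simp add: finite_quaternion_part)
  also have "\<dots> = card (set [\<one>, a, a \<otimes> a]) * card quaternion_part" by (rule card_cartesian_product)
  also have "\<dots> \<le> 3 * 8"
    unfolding quaternion_part_def by (rule mult_le_mono; rule order_trans[OF card_length]; simp)
  finally show ?thesis by simp
qed

text \<open>
  If the central element is not trivial, the eight quaternion words are distinct, and \<open>a\<close> has
  order 3; so both 8 and 3 divide the order of the group.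
\<close>

lemma card_eq_24:
  assumes z: "z \<noteq> \<one>"
  shows "card (carrier G) = 24"
proof -
  have c1: "c \<noteq> \<one>" "c \<noteq> z" and d1: "d \<noteq> \<one>" "d \<noteq> z"
    using z z_def d_squared z_squared by auto
  have cd: "c \<noteq> d"
  proof
    assume "c = d"
    then have "a \<otimes> c = a \<otimes> z" using c_a d_a by (simp add: d_squared)
    then show False using c1 by simp
  qed
  have czd: "c \<noteq> z \<otimes> d"
  proof
    assume "c = z \<otimes> d"
    then have "d \<otimes> a = a \<otimes> (d \<otimes> (z \<otimes> d))" using d_a by simp
    also have "\<dots> = a" by (simp add: m_assoc pair_rewrites)
    finally have "d = \<one>" by simp
    then show False using d1 by simp
  qed
  \<comment> \<open>puts every possible coincidence of two words into one of the shapes already excluded\<close>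
  have move: "x = z \<otimes> y \<longleftrightarrow> z \<otimes> x = y" if "x \<in> carrier G" "y \<in> carrier G" for x y
    using that z_squared assoc_rule[OF z_squared] by (metis cdz_carrier(3) l_one)
  have "card quaternion_part = 8"
  proof -
    have cd1: "c \<otimes> d \<noteq> \<one>" "c \<otimes> d \<noteq> z"
    proof -
      have e: "c \<otimes> (c \<otimes> d) = z \<otimes> d" by (simp add: pair_rewrites)
      show "c \<otimes> d \<noteq> \<one>" using e czd by auto
      show "c \<otimes> d \<noteq> z" using e cd by (auto simp: c_z)
    qed
    have cd2: "c \<otimes> d \<noteq> z \<otimes> c" "c \<otimes> d \<noteq> z \<otimes> d"
      using c1 d1 by (auto simp: c_z [symmetric])
    have "distinct [\<one>, z, c, z \<otimes> c, d, z \<otimes> d, c \<otimes> d, z \<otimes> (c \<otimes> d)]"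
      using z c1 d1 cd czd cd1 cd2
      by (auto simp: move pair_rewrites dest: sym)
    then show ?thesis unfolding quaternion_part_def by (simp only: distinct_card) simp
  qed
  then have "8 dvd order G" using lagrange[OF quaternion_part_subgroup] by (metis dvd_triv_right)
  moreover have "3 dvd order G"
  proof -
    have "a \<noteq> \<one>"
    proof
      assume a: "a = \<one>"
      have "c = d" unfolding c_def d_def by (simp add: a)
      then show False using cd by simp
    qed
    moreover have "a [^] (3::nat) = \<one>"
      using a_cubed by (simp add: numeral_3_eq_3 m_assoc)
    then have "ord a dvd 3" by (simp add: pow_eq_id)
    moreover have "ord a \<in> {0, 1, 2, 3}"
      using dvd_imp_le[OF \<open>ord a dvd 3\<close>] by auto
    ultimately have "ord a = 3"
      using \<open>ord a dvd 3\<close> ord_eq_1[of a] by auto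
    then show ?thesis using ord_dvd_group_order[of a] by simp
  qed
  ultimately have "24 dvd order G" by presburger
  moreover have "order G > 0" using finite_carrier by (simp add: order_gt_0_iff_finite)
  ultimately have "24 \<le> card (carrier G)" by (simp add: order_def dvd_imp_le)
  then show ?thesis using card_le_24 by simp
qed

end

text \<open>
  The subgroup \<open>D\<close> of \<open>G \<times> H\<close> generated by \<open>(a, a')\<close> and \<open>(b, b')\<close> satisfies the same relations,
  so it has at most 24 elements. It projects onto both groups, which have exactly 24, so both
  projections are bijective: \<open>D\<close> is the graph of an isomorphism.
\<close>

lemma bolza_pairs_isomorphic:
  assumes "bolza_pair G a b" "bolza_pair H a' b'"
    and "a \<otimes>\<^bsub>G\<^esub> b \<otimes>\<^bsub>G\<^esub> (a \<otimes>\<^bsub>G\<^esub> b) \<noteq> \<one>\<^bsub>G\<^esub>" "a' \<otimes>\<^bsub>H\<^esub> b' \<otimes>\<^bsub>H\<^esub> (a' \<otimes>\<^bsub>H\<^esub> b') \<noteq> \<one>\<^bsub>H\<^esub>"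
  shows "G \<cong> H"
proof -
  interpret G: bolza_pair G a b by fact
  interpret H: bolza_pair H a' b' by fact
  interpret P: group "G \<times>\<times> H" by (intro DirProd_group G.group_axioms H.group_axioms)
  let ?S = "{(a, a'), (b, b')}"
  define D where "D = generate (G \<times>\<times> H) ?S"
  let ?D = "(G \<times>\<times> H)\<lparr>carrier := D\<rparr>"
  have S: "?S \<subseteq> carrier (G \<times>\<times> H)" by auto
  have sub: "subgroup D (G \<times>\<times> H)" unfolding D_def by (rule P.generate_is_subgroup[OF S])
  have "?S \<subseteq> D" unfolding D_def by (auto intro: generate.incl)
  interpret D: bolza_pair ?D "(a, a')" "(b, b')"
  proof (intro bolza_pair.intro bolza_pair_axioms.intro)
    show "group ?D" by (rule P.subgroup_imp_group[OF sub])
    have "generate ?D ?S = D"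
      using P.generate_consistent[OF \<open>?S \<subseteq> D\<close> sub] by (simp add: D_def)
    then show "carrier ?D = generate ?D ?S" by simp
  qed (use \<open>?S \<subseteq> D\<close> G.a_cubed G.b_cubed G.ab_fourth G.ab_squared
        H.a_cubed H.b_cubed H.ab_fourth H.ab_squared in auto)
  have iso: "h \<in> iso ?D K"
    if h: "group_hom (G \<times>\<times> H) K h" and K: "bolza_pair K x y" "h ` ?S = {x, y}"
      and nontriv: "x \<otimes>\<^bsub>K\<^esub> y \<otimes>\<^bsub>K\<^esub> (x \<otimes>\<^bsub>K\<^esub> y) \<noteq> \<one>\<^bsub>K\<^esub>" for K h x y
  proof -
    interpret h: group_hom "G \<times>\<times> H" K h by (rule h)
    interpret K: bolza_pair K x y by (rule K(1))
    have im: "h ` D = carrier K"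
      unfolding D_def h.generate_img[OF S, symmetric] K(2) K.generated ..
    have "card (carrier K) = 24"
      using nontriv by (intro K.card_eq_24) (simp add: K.z_def K.c_def)
    then have "card (h ` D) = card D"
      using im D.card_le_24 card_image_le[of D h] D.finite_carrier by simp
    then have "inj_on h D" using D.finite_carrier by (simp add: eq_card_imp_inj_on)
    moreover have "h \<in> hom ?D K"
      using h.homh subgroup.mem_carrier[OF sub] unfolding hom_def by auto
    ultimately show ?thesis
      using im by (simp add: iso_def bij_betw_def)
  qed
  have "fst \<in> iso ?D G"
    by (rule iso[of _ _ a b]) (auto simp: group_hom_def group_hom_axioms_def hom_def assms)
  moreover have "snd \<in> iso ?D H"
    by (rule iso[of _ _ a' b']) (auto simp: group_hom_def group_hom_axioms_def hom_def assms)
  ultimately have "?D \<cong> G" "?D \<cong> H" by (auto simp: is_iso_def)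
  then show ?thesis using D.iso_sym[of G] iso_trans[of G ?D H] by blast
qed

section \<open>The special linear group over the field with three elements\<close>

lemma F3_cases: "(x::3) = 0 \<or> x = 1 \<or> x = 2"
  using forall_3[of "\<lambda>x. x = 0 \<or> x = 1 \<or> x = 2"] by auto

lemma F3_three: "(3::3) = 0"
  by simp

definition mat2 :: "'a \<Rightarrow> 'a \<Rightarrow> 'a \<Rightarrow> 'a \<Rightarrow> 'a^2^2" where
  "mat2 p q r s = (\<chi> i j. if i = 1 then (if j = 1 then p else q) else (if j = 1 then r else s))"

lemma mat2_surj: "A = mat2 (A $ 1 $ 1) (A $ 1 $ 2) (A $ 2 $ 1) (A $ 2 $ 2)"
  by (simp add: mat2_def vec_eq_iff forall_2)

lemma mat2_eq_iff: "mat2 p q r s = mat2 p' q' r' s' \<longleftrightarrow> p = p' \<and> q = q' \<and> r = r' \<and> s = s'"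
  by (auto simp: mat2_def vec_eq_iff forall_2)

lemma mat2_mult: "mat2 p q r s ** mat2 p' q' r' s' =
    mat2 (p * p' + q * r') (p * q' + q * s') (r * p' + s * r') (r * q' + s * (s'::'a::comm_ring_1))"
  by (simp add: mat2_def matrix_matrix_mult_def vec_eq_iff forall_2 sum_2)

lemma mat2_one: "mat 1 = mat2 1 0 0 (1::'a::comm_ring_1)"
  by (simp add: mat2_def mat_def vec_eq_iff forall_2)

lemma det_mat2: "det (mat2 p q r s) = p * s - q * (r::'a::comm_ring_1)"
  by (simp add: det_2 mat2_def)

lemma SL2_F3_mat2: "mat2 p q r s \<in> carrier SL2_F3 \<longleftrightarrow> p * s - q * r = 1"
  by (simp add: SL2_F3_def det_mat2)

lemma SL2_F3_group: "group SL2_F3"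
proof (rule groupI)
  fix A assume A: "A \<in> carrier SL2_F3"
  obtain p q r s where A_eq: "A = mat2 p q r s" using mat2_surj by blast
  then have "p * s - q * r = 1" using A SL2_F3_mat2 by simp
  then show "\<exists>B\<in>carrier SL2_F3. B \<otimes>\<^bsub>SL2_F3\<^esub> A = \<one>\<^bsub>SL2_F3\<^esub>"
    by (intro bexI[of _ "mat2 s (- q) (- r) p"])
      (simp_all add: A_eq SL2_F3_mat2 SL2_F3_def[THEN arg_cong[of _ _ monoid.mult]]
        SL2_F3_def[THEN arg_cong[of _ _ one]] mat2_mult mat2_one mat2_eq_iff algebra_simps)
qed (auto simp: SL2_F3_def det_mul matrix_mul_assoc)

abbreviation upper :: "3 \<Rightarrow> 3^2^2" where "upper x \<equiv> mat2 1 x 0 1"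
abbreviation lower :: "3 \<Rightarrow> 3^2^2" where "lower x \<equiv> mat2 1 0 x 1"

lemma SL2_F3_mult: "A \<otimes>\<^bsub>SL2_F3\<^esub> B = A ** B" and SL2_F3_one: "\<one>\<^bsub>SL2_F3\<^esub> = mat2 1 0 0 1"
  by (simp_all add: SL2_F3_def mat2_one)

text \<open>
  The two elementary matrices generate by Gaussian elimination. Their product has trace 0,
  so its square is \<open>-1\<close>, which gives the remaining relations.
\<close>

lemma SL2_F3_elementary_pair:
  "bolza_pair SL2_F3 (upper 1) (lower 1)"
proof (intro bolza_pair.intro bolza_pair_axioms.intro)
  interpret group SL2_F3 by (rule SL2_F3_group)
  let ?E = "generate SL2_F3 {upper 1, lower 1}"
  have S: "{upper 1, lower 1} \<subseteq> carrier SL2_F3" by (simp add: SL2_F3_mat2)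
  interpret E: subgroup ?E SL2_F3 by (rule generate_is_subgroup[OF S])
  have mult: "A ** B \<in> ?E" if "A \<in> ?E" "B \<in> ?E" for A B
    using E.m_closed[OF that] by (simp add: SL2_F3_mult)
  have 1: "upper 0 \<in> ?E" "lower 0 \<in> ?E" "upper 1 \<in> ?E" "lower 1 \<in> ?E"
    using E.one_closed by (auto simp: SL2_F3_one intro: generate.incl)
  have "upper 1 ** upper 1 \<in> ?E" "lower 1 ** lower 1 \<in> ?E" by (intro mult 1)+
  then have 2: "upper 2 \<in> ?E" "lower 2 \<in> ?E" by (simp_all add: mat2_mult)
  have upper: "upper x \<in> ?E" and lower: "lower x \<in> ?E" for x
    using F3_cases[of x] 1 2 by auto
  have nz: "mat2 p q r s \<in> ?E" if "p * s - q * r = 1" "r \<noteq> 0" for p q r s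
  proof -
    \<comment> \<open>thus \<open>r\<close> is its own inverse, and elimination with pivot \<open>r\<close> needs no division\<close>
    have "r * r = 1" using that(2) F3_cases[of r] by auto
    then have "mat2 p q r s = upper ((p - 1) * r) ** (lower r ** upper ((s - 1) * r))"
      using that(1) F3_cases[of r] F3_cases[of p] F3_cases[of s] F3_cases[of q]
      by (auto simp: mat2_mult mat2_eq_iff)
    then show ?thesis by (simp add: mult upper lower)
  qed
  have all: "mat2 p q r s \<in> ?E" if det: "p * s - q * r = 1" for p q r s
  proof (cases "r = 0")
    case True
    then have "p \<noteq> 0" using det by auto
    have "mat2 p q p (q + s) \<in> ?E" using det True \<open>p \<noteq> 0\<close> by (intro nz) (auto simp: algebra_simps)
    moreover have "mat2 p q r s = lower 2 ** mat2 p q p (q + s)"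
      using True by (simp add: mat2_mult mat2_eq_iff) (simp add: algebra_simps F3_three)
    ultimately show ?thesis by (simp add: mult lower)
  qed (use nz det in auto)
  show "carrier SL2_F3 = ?E"
  proof
    show "carrier SL2_F3 \<subseteq> ?E"
      using all mat2_surj SL2_F3_mat2 by (metis subsetI)
  qed (rule E.subset)
qed (simp_all add: SL2_F3_group SL2_F3_mat2 SL2_F3_mult SL2_F3_one mat2_mult mat2_eq_iff)

lemma SL2_F3_pair_nontrivial:
  "upper 1 \<otimes>\<^bsub>SL2_F3\<^esub> lower 1 \<otimes>\<^bsub>SL2_F3\<^esub> (upper 1 \<otimes>\<^bsub>SL2_F3\<^esub> lower 1) \<noteq> \<one>\<^bsub>SL2_F3\<^esub>"
  by (simp add: SL2_F3_mult SL2_F3_one mat2_mult mat2_eq_iff)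

section \<open>Coordinates on the quaternion order\<close>

lemma O_K_iff: "x \<in> O_K \<longleftrightarrow> (\<exists>m n. x = of_int m + of_int n * sqrt 2)"
  unfolding O_K_def Ints_def by auto

lemma O_K_I: "of_int m + of_int n * sqrt 2 \<in> O_K" for m n :: int
  unfolding O_K_iff by blast

lemma O_K_of_int [simp]: "of_int m \<in> O_K" for m :: int
  using O_K_I[of m 0] by simp

lemma O_K_numeral [simp]: "0 \<in> O_K" "1 \<in> O_K" "numeral k \<in> O_K" "sqrt 2 \<in> O_K"
  using O_K_of_int[of 0] O_K_of_int[of 1] O_K_of_int[of "numeral k"] O_K_I[of 0 1] by simp_all

lemma O_K_uminus: "x \<in> O_K \<Longrightarrow> - x \<in> O_K"
proof -
  assume "x \<in> O_K"
  then obtain m n :: int where "x = of_int m + of_int n * sqrt 2"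
    unfolding O_K_iff by blast
  then show ?thesis using O_K_I[of "- m" "- n"] by simp
qed

lemma O_K_add: "x \<in> O_K \<Longrightarrow> y \<in> O_K \<Longrightarrow> x + y \<in> O_K"
proof -
  assume "x \<in> O_K" "y \<in> O_K"
  then obtain m n k l :: int
    where "x = of_int m + of_int n * sqrt 2" "y = of_int k + of_int l * sqrt 2"
    unfolding O_K_iff by blast
  then show ?thesis using O_K_I[of "m + k" "n + l"] by (simp add: algebra_simps)
qed

lemma O_K_mult: "x \<in> O_K \<Longrightarrow> y \<in> O_K \<Longrightarrow> x * y \<in> O_K"
proof -
  assume "x \<in> O_K" "y \<in> O_K"
  then obtain m n k l :: int
    where "x = of_int m + of_int n * sqrt 2" "y = of_int k + of_int l * sqrt 2"
    unfolding O_K_iff by blast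
  then show ?thesis using O_K_I[of "m * k + 2 * (n * l)" "m * l + n * k"] by (simp add: algebra_simps)
qed

lemma O_K_diff: "x \<in> O_K \<Longrightarrow> y \<in> O_K \<Longrightarrow> x - y \<in> O_K"
  using O_K_add[of x "- y"] O_K_uminus[of y] by simp

lemma O_K_power: "x \<in> O_K \<Longrightarrow> x ^ n \<in> O_K"
  by (induction n) (auto intro: O_K_mult)

lemmas O_K_closed = O_K_add O_K_mult O_K_diff O_K_uminus O_K_power

text \<open>
  The element \<open>p + q \<alpha> + r \<beta> + s \<alpha>\<beta>\<close>.
\<close>

definition span_elem :: "real \<Rightarrow> real \<Rightarrow> real \<Rightarrow> real \<Rightarrow> real quat" where
  "span_elem p q r s = Quat (p + q/2 + r/2 - sqrt 2/2 * s)
     (q/2 + (1 + 2 * sqrt 2)/6 * r + (2 + sqrt 2)/6 * s) (s/2) (- r/3 - s/6)"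

lemma span_elem_add:
  "quat_add (span_elem p q r s) (span_elem p' q' r' s') = span_elem (p + p') (q + q') (r + r') (s + s')"
  by (simp add: quat_add_def span_elem_def field_simps)

text \<open>
  The structure constants come from \<open>\<alpha>\<^sup>2 = \<alpha> - 1\<close>, \<open>\<beta>\<^sup>2 = \<beta> - 1\<close> and \<open>\<beta>\<alpha> = \<alpha> + \<beta> - 1 - sqrt 2 - \<alpha>\<beta>\<close>.
  They lie in \<open>O_K\<close>, which is why \<open>1, \<alpha>, \<beta>, \<alpha>\<beta>\<close> span a ring over \<open>O_K\<close>.
\<close>

lemma span_elem_mult:
  "quat_mult (-3) (sqrt 2) (span_elem p q r s) (span_elem p' q' r' s') = span_elem
     (p * p' - q * q' - r * r' - s * s' - (1 + sqrt 2) * r * q' - r * s' - s * q')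
     (p * q' + q * p' + q * q' + r * q' + r * s' - sqrt 2 * s * q' - s * r')
     (p * r' + r * p' + r * r' - q * s' + r * q' - sqrt 2 * r * s' + s * q')
     (p * s' + s * p' + q * r' + q * s' - r * q' + s * r' - sqrt 2 * s * s')"
proof -
  have s: "sqrt 2 * (sqrt 2 * x) = 2 * x" for x :: real
    by (simp add: mult.assoc[symmetric])
  show ?thesis
    by (simp add: quat_mult_def span_elem_def field_simps s)
qed

text \<open>
  The reduced norm in the coordinates of \<open>span_elem\<close>, with \<open>t\<close> in the place of \<open>sqrt 2\<close> so that the
  Galois conjugate form, \<open>t = - sqrt 2\<close>, is an instance too.
\<close>

definition norm_form :: "real \<Rightarrow> real \<Rightarrow> real \<Rightarrow> real \<Rightarrow> real \<Rightarrow> real" where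
  "norm_form t p q r s = p\<^sup>2 + q\<^sup>2 + r\<^sup>2 + s\<^sup>2 + p * q + p * r - t * p * s + (1 + t) * q * r + q * s + r * s"

lemma reduced_norm_span_elem:
  "reduced_norm (-3) (sqrt 2) (span_elem p q r s) = norm_form (sqrt 2) p q r s"
proof -
  have s: "sqrt 2 * (sqrt 2 * x) = 2 * x" for x :: real
    by (simp add: mult.assoc[symmetric])
  show ?thesis
    by (simp add: reduced_norm_def span_elem_def norm_form_def power2_eq_square field_simps s)
qed

lemma Q_B_span:
  assumes "x \<in> Q_B"
  obtains p q r s where "p \<in> O_K" "q \<in> O_K" "r \<in> O_K" "s \<in> O_K" "x = span_elem p q r s"
proof -
  let ?L = "{span_elem p q r s | p q r s. p \<in> O_K \<and> q \<in> O_K \<and> r \<in> O_K \<and> s \<in> O_K}"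
  interpret ring D_B by (rule D_B_ring)
  have L_I: "x \<in> ?L" if "x = span_elem p q r s" "p \<in> O_K" "q \<in> O_K" "r \<in> O_K" "s \<in> O_K" for x p q r s
    using that by blast
  have half: "1/2 \<in> K" "1/3 \<in> K" "1/6 \<in> K" "1 \<in> K" "2 \<in> K" by (intro Rats_subset_K; simp)+
  have L_carrier: "span_elem p q r s \<in> carrier D_B"
    if "p \<in> O_K" "q \<in> O_K" "r \<in> O_K" "s \<in> O_K" for p q r s
  proof -
    have "p \<in> K" "q \<in> K" "r \<in> K" "s \<in> K" using that O_K_subset_K by blast+
    then have "p + (1/2) * q + (1/2) * r - sqrt 2 * (1/2) * s \<in> K"
      "(1/2) * q + (1 + 2 * sqrt 2) * (1/6) * r + (2 + sqrt 2) * (1/6) * s \<in> K"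
      "(1/2) * s \<in> K" "- ((1/3) * r) - (1/6) * s \<in> K"
      using half sqrt2_in_K by (intro K_closed; simp)+
    then show ?thesis by (simp add: span_elem_def D_B_def quaternion_algebra_def)
  qed
  have "subring ?L D_B"
  proof (rule subringI)
    show "?L \<subseteq> carrier D_B" using L_carrier by blast
    show "\<one>\<^bsub>D_B\<^esub> \<in> ?L"
      by (rule L_I[of _ 1 0 0 0]) (simp_all add: span_elem_def D_B_def quaternion_algebra_def quat_of_def)
    fix x assume "x \<in> ?L"
    then obtain p q r s where x: "x = span_elem p q r s" "p \<in> O_K" "q \<in> O_K" "r \<in> O_K" "s \<in> O_K"
      by blast
    have "span_elem (-p) (-q) (-r) (-s) \<oplus>\<^bsub>D_B\<^esub> x = \<zero>\<^bsub>D_B\<^esub>"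
      by (simp add: x D_B_def quaternion_algebra_def span_elem_add)
        (simp add: span_elem_def quat_of_def)
    then have "\<ominus>\<^bsub>D_B\<^esub> x = span_elem (-p) (-q) (-r) (-s)"
      using x by (intro minus_equality) (auto intro!: L_carrier O_K_closed)
    then show "\<ominus>\<^bsub>D_B\<^esub> x \<in> ?L" by (rule L_I) (auto intro: O_K_closed x)
    fix y assume "y \<in> ?L"
    then obtain p' q' r' s' where y: "y = span_elem p' q' r' s'" "p' \<in> O_K" "q' \<in> O_K" "r' \<in> O_K" "s' \<in> O_K"
      by blast
    show "x \<oplus>\<^bsub>D_B\<^esub> y \<in> ?L"
      by (rule L_I) (auto simp: x y D_B_def quaternion_algebra_def span_elem_add intro: O_K_closed x y)
    show "x \<otimes>\<^bsub>D_B\<^esub> y \<in> ?L"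
      by (rule L_I, simp add: x y D_B_def quaternion_algebra_def, rule span_elem_mult)
        (intro O_K_closed x y O_K_numeral)+
  qed
  moreover have "quat_of ` O_K \<union> {\<alpha>, \<beta>} \<subseteq> ?L"
  proof -
    have "quat_of x \<in> ?L" if "x \<in> O_K" for x
      by (rule L_I[of _ x 0 0 0]) (simp_all add: that quat_of_def span_elem_def)
    moreover have "\<alpha> \<in> ?L"
      by (rule L_I[of _ 0 1 0 0]) (simp_all add: \<alpha>_def span_elem_def)
    moreover have "\<beta> \<in> ?L"
      by (rule L_I[of _ 0 0 1 0]) (simp_all add: \<beta>_def span_elem_def)
    ultimately show ?thesis by (intro Un_least image_subsetI insert_subsetI empty_subsetI)
  qed
  ultimately have "Q_B \<subseteq> ?L"
    unfolding Q_B_def by (rule generate_ring_min_subring1 [OF gens_in_D_B])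
  then have "x \<in> ?L" using assms by (rule subsetD)
  then show ?thesis using that by (elim CollectE exE conjE)
qed

section \<open>Galois conjugation and the discreteness of the height\<close>

lemma sqrt_2_coordinates_unique:
  fixes k l m n :: int
  assumes "of_int k + of_int l * sqrt 2 = of_int m + of_int n * sqrt 2"
  shows "k = m" "l = n"
proof -
  define x y where "x = k - m" and "y = l - n"
  have "of_int x = - of_int y * sqrt 2"
    using assms by (simp add: x_def y_def algebra_simps)
  then have "(of_int x)\<^sup>2 = 2 * (of_int y :: real)\<^sup>2" by (simp add: power_mult_distrib)
  then have "of_int (x\<^sup>2) = (of_int (2 * y\<^sup>2) :: real)" by simp
  then have eq: "x\<^sup>2 = 2 * y\<^sup>2" by (simp only: of_int_eq_iff)
  have "y = 0"
  proof (rule ccontr)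
    assume "y \<noteq> 0"
    then have g: "gcd x y \<noteq> 0" by simp
    then obtain x' y' where xy: "x = x' * gcd x y" "y = y' * gcd x y" "coprime x' y'"
      using gcd_coprime_exists by blast
    define d where "d = gcd x y"
    have "(x' * d)\<^sup>2 = 2 * (y' * d)\<^sup>2" using eq xy(1,2) unfolding d_def by metis
    moreover have "d \<noteq> 0" using g by (simp add: d_def)
    ultimately have eq': "x'\<^sup>2 = 2 * y'\<^sup>2" by (simp add: power_mult_distrib)
    then have "even (x'\<^sup>2)" by simp
    then have "even x'" by simp
    then obtain w where "x' = 2 * w" by blast
    then have "y'\<^sup>2 = 2 * w\<^sup>2" using eq' by (simp add: power2_eq_square)
    then have "even (y'\<^sup>2)" by simp
    then have "even y'" by simp
    then show False using \<open>even x'\<close> xy(3) by (simp add: coprime_iff_gcd_eq_1) (use coprime_common_divisor xy(3) in fastforce)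
  qed
  moreover from this eq have "x = 0" by simp
  ultimately show "k = m" "l = n" by (simp_all add: x_def y_def)
qed

text \<open>
  The nontrivial automorphism of \<open>K\<close>, on \<open>O_K\<close>.
\<close>

definition galois :: "real \<Rightarrow> real" where
  "galois x = (THE y. \<exists>m n. x = of_int m + of_int n * sqrt 2 \<and> y = of_int m - of_int n * sqrt 2)"

lemma galois_eq: "galois (of_int m + of_int n * sqrt 2) = of_int m - of_int n * sqrt 2"
  unfolding galois_def by (rule the_equality) (auto dest: sqrt_2_coordinates_unique)

lemma galois_sqrt_2 [simp]: "galois (sqrt 2) = - sqrt 2" "galois 1 = 1"
  using galois_eq[of 0 1] galois_eq[of 1 0] by simp_all

lemma galois_add: "x \<in> O_K \<Longrightarrow> y \<in> O_K \<Longrightarrow> galois (x + y) = galois x + galois y"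
proof -
  assume "x \<in> O_K" "y \<in> O_K"
  then obtain m n k l :: int
    where "x = of_int m + of_int n * sqrt 2" "y = of_int k + of_int l * sqrt 2"
    unfolding O_K_iff by blast
  then show ?thesis using galois_eq[of "m + k" "n + l"] by (simp add: galois_eq algebra_simps)
qed

lemma galois_mult: "x \<in> O_K \<Longrightarrow> y \<in> O_K \<Longrightarrow> galois (x * y) = galois x * galois y"
proof -
  assume "x \<in> O_K" "y \<in> O_K"
  then obtain m n k l :: int
    where "x = of_int m + of_int n * sqrt 2" "y = of_int k + of_int l * sqrt 2"
    unfolding O_K_iff by blast
  then show ?thesis using galois_eq[of "m * k + 2 * (n * l)" "m * l + n * k"]
    by (simp add: galois_eq algebra_simps)
qed

lemma galois_minus: "x \<in> O_K \<Longrightarrow> y \<in> O_K \<Longrightarrow> galois (x - y) = galois x - galois y"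
  using galois_add[of "x - y" y] by (simp add: O_K_closed)

text \<open>
  The norm of \<open>u + v j\<close> is \<open>\<bar>u\<bar>\<^sup>2 - t \<bar>v\<bar>\<^sup>2\<close>, where \<open>u\<close> and \<open>v\<close> lie in \<open>K(i)\<close>. It is
  indefinite for \<open>t = sqrt 2\<close> but positive definite for \<open>t = - sqrt 2\<close>.
\<close>

lemma norm_form_squares:
  assumes "t\<^sup>2 = 2"
  shows "norm_form t p q r s = (p + q/2 + r/2 - t/2 * s)\<^sup>2
     + 3 * (q/2 + (1 + 2 * t)/6 * r + (2 + t)/6 * s)\<^sup>2 - t * (r\<^sup>2 + r * s + s\<^sup>2) / 3"
proof -
  have t: "t * (t * x) = 2 * x" for x
    using assms by (simp add: mult.assoc[symmetric] power2_eq_square)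
  show ?thesis by (simp add: norm_form_def power2_eq_square field_simps t)
qed

lemma galois_norm_form:
  assumes "p \<in> O_K" "q \<in> O_K" "r \<in> O_K" "s \<in> O_K"
  shows "galois (norm_form (sqrt 2) p q r s) =
     norm_form (- sqrt 2) (galois p) (galois q) (galois r) (galois s)"
  unfolding norm_form_def power2_eq_square
  by (simp add: galois_add galois_mult galois_minus assms O_K_closed)

text \<open>
  This is \<open>\<bar>v\<bar>\<^sup>2\<close> for \<open>u + v j\<close>. On elements of norm 1 acting on the hyperbolic plane it is an
  increasing function of the distance by which the fixed point of \<open>\<alpha>\<close> is moved.
\<close>

definition height :: "real quat \<Rightarrow> real" where
  "height x = (qj x)\<^sup>2 + 3 * (qij x)\<^sup>2"

lemma height_span_elem: "3 * height (span_elem p q r s) = r\<^sup>2 + r * s + s\<^sup>2"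
  by (simp add: height_def span_elem_def power2_eq_square field_simps)

lemma binary_form_nonneg: "0 \<le> r\<^sup>2 + r * s + (s::real)\<^sup>2"
proof -
  have "r\<^sup>2 + r * s + s\<^sup>2 = (r + s/2)\<^sup>2 + 3/4 * s\<^sup>2" by (simp add: power2_eq_square field_simps)
  then show ?thesis by simp
qed

lemma sqrt_2_bounds: "1.4 < sqrt 2" "sqrt 2 < 1.42"
  by (rule real_less_rsqrt, simp add: power2_eq_square) (rule real_less_lsqrt, simp_all add: power2_eq_square)

text \<open>
  Let \<open>B\<close> be the binary form. Positive definiteness at the other real place bounds its Galois
  conjugate above, by \<open>3 / sqrt 2\<close>, and both conjugates are nonnegative. Together these force
  \<open>B = k + l sqrt 2\<close> to have \<open>l \<ge> 0\<close>; then \<open>B\<close> is an integer if \<open>l = 0\<close> and exceeds 1 otherwise.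
\<close>

lemma height_gap:
  assumes "p \<in> O_K" "q \<in> O_K" "r \<in> O_K" "s \<in> O_K" and norm: "norm_form (sqrt 2) p q r s = 1"
  shows "r\<^sup>2 + r * s + s\<^sup>2 = 0 \<or> 1 \<le> r\<^sup>2 + r * s + s\<^sup>2"
proof -
  let ?B = "r\<^sup>2 + r * s + s\<^sup>2"
  have "?B \<in> O_K" by (intro O_K_closed assms)
  then obtain k l :: int where kl: "?B = of_int k + of_int l * sqrt 2"
    unfolding O_K_iff by blast
  have conj: "(galois r)\<^sup>2 + galois r * galois s + (galois s)\<^sup>2 = of_int k - of_int l * sqrt 2"
    unfolding galois_eq[symmetric] kl[symmetric]
    by (simp add: power2_eq_square galois_add galois_mult assms O_K_closed)
  have aux: "E \<le> 1" if "A\<^sup>2 + 3 * C\<^sup>2 + E = 1" for A C E :: real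
    using that zero_le_power2[of A] zero_le_power2[of C] by linarith
  have "norm_form (- sqrt 2) (galois p) (galois q) (galois r) (galois s) = 1"
    using galois_norm_form[OF assms(1-4)] norm by simp
  then have "sqrt 2 * (of_int k - of_int l * sqrt 2) \<le> 3"
    unfolding norm_form_squares[of "- sqrt 2", simplified]
    by (simp add: conj) (drule aux, linarith)
  moreover have "1.4 * (of_int k - of_int l * sqrt 2) \<le> sqrt 2 * (of_int k - of_int l * sqrt 2)"
    using sqrt_2_bounds binary_form_nonneg[of "galois r" "galois s"] conj
    by (intro mult_right_mono) simp_all
  ultimately have "1.4 * (of_int k - of_int l * sqrt 2) \<le> 3" by linarith
  then have le: "of_int k - of_int l * sqrt 2 < 2.8" by simp
  have nonneg: "0 \<le> of_int k - of_int l * sqrt 2" "0 \<le> of_int k + of_int l * sqrt 2"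
    using binary_form_nonneg[of "galois r" "galois s"] conj binary_form_nonneg[of r s] kl by simp_all
  consider "l \<ge> 1" | "l = 0" | "l \<le> -1" by linarith
  then show ?thesis
  proof cases
    case 1
    then have "sqrt 2 \<le> of_int l * sqrt 2" by simp
    then show ?thesis using kl nonneg sqrt_2_bounds by linarith
  next
    case 2
    then show ?thesis using kl nonneg by simp linarith
  next
    case 3
    then have "of_int l \<le> (- 1 :: real)" by linarith
    from mult_right_mono[OF this, of "sqrt 2"]
    have "of_int l * sqrt 2 \<le> - sqrt 2" by simp
    then show ?thesis using le nonneg sqrt_2_bounds by linarith
  qed
qed

text \<open>
  The sum of the squares of the two conjugates of \<open>m + n sqrt 2\<close> is \<open>2m\<^sup>2 + 4n\<^sup>2\<close>.
\<close>

lemma small_integer: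
  assumes "x \<in> O_K" "x\<^sup>2 \<le> 4/3" "(galois x)\<^sup>2 \<le> 4/3"
  shows "x \<in> {-1, 0, 1}"
proof -
  obtain m n :: int where x: "x = of_int m + of_int n * sqrt 2"
    using assms(1) unfolding O_K_iff by blast
  have "x\<^sup>2 + (galois x)\<^sup>2 = of_int (2 * m\<^sup>2 + 4 * n\<^sup>2)"
    by (simp add: x galois_eq power2_eq_square algebra_simps)
  then have "of_int (2 * m\<^sup>2 + 4 * n\<^sup>2) < (3 :: real)" using assms by linarith
  then have "2 * m\<^sup>2 + 4 * n\<^sup>2 < 3" by linarith
  moreover have "m\<^sup>2 \<ge> 0" "n\<^sup>2 \<ge> 0" by simp_all
  ultimately have "n\<^sup>2 = 0" "m\<^sup>2 \<le> 1" by linarith+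
  then have "n = 0" "\<bar>m\<bar> \<le> 1" by (simp_all add: abs_square_le_1)
  then show ?thesis using x by auto
qed

lemma binary_form_bound:
  assumes "p\<^sup>2 + p * q + q\<^sup>2 = (1::real)" shows "p\<^sup>2 \<le> 4/3" "q\<^sup>2 \<le> 4/3"
proof -
  have "1 = (p + q/2)\<^sup>2 + 3/4 * q\<^sup>2" "1 = (q + p/2)\<^sup>2 + 3/4 * p\<^sup>2"
    unfolding assms[symmetric] by (simp_all add: power2_eq_square field_simps)
  then show "p\<^sup>2 \<le> 4/3" "q\<^sup>2 \<le> 4/3" 
    using zero_le_power2[of "p + q/2"] zero_le_power2[of "q + p/2"] by linarith+
qed

text \<open>
  Below height \<open>1/3\<close> the gap forces height 0, so the element fixes the base point and lies in
  \<open>O_K[\<alpha>]\<close>. The norm equation and its conjugate then leave only the powers of \<open>\<alpha>\<close>.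
\<close>

lemma height_zero_cases:
  assumes "x \<in> Q_B" "reduced_norm (-3) (sqrt 2) x = 1" "height x < 1/3"
  shows "x \<in> {span_elem 1 0 0 0, span_elem (-1) 0 0 0, span_elem 0 1 0 0, span_elem 0 (-1) 0 0,
     span_elem 1 (-1) 0 0, span_elem (-1) 1 0 0}"
proof -
  obtain p q r s where O: "p \<in> O_K" "q \<in> O_K" "r \<in> O_K" "s \<in> O_K" and x: "x = span_elem p q r s"
    using Q_B_span[OF assms(1)] .
  have norm: "norm_form (sqrt 2) p q r s = 1"
    using assms(2) by (simp add: x reduced_norm_span_elem)
  have "r\<^sup>2 + r * s + s\<^sup>2 = 0"
    using height_gap[OF O norm] assms(3)[unfolded x] height_span_elem[of p q r s] by linarith
  then have "(r + s/2)\<^sup>2 + 3/4 * s\<^sup>2 = 0" by (simp add: power2_eq_square field_simps)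
  then have "s\<^sup>2 = 0" "(r + s/2)\<^sup>2 = 0"
    using zero_le_power2[of s] zero_le_power2[of "r + s/2"] by linarith+
  then have rs: "s = 0" "r = 0" by simp_all
  have "p\<^sup>2 + p * q + q\<^sup>2 = 1" using norm by (simp add: norm_form_def rs)
  moreover from arg_cong[OF this, of galois]
  have "(galois p)\<^sup>2 + galois p * galois q + (galois q)\<^sup>2 = 1"
    by (simp add: power2_eq_square galois_add galois_mult O O_K_closed)
  ultimately have "p \<in> {-1,0,1}" "q \<in> {-1,0,1}"
    using small_integer[OF O(1)] small_integer[OF O(2)] binary_form_bound by blast+
  then show ?thesis using \<open>p\<^sup>2 + p * q + q\<^sup>2 = 1\<close> by (auto simp: x rs)
qed

section \<open>Generation of the norm one group\<close>

text \<open>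
  For \<open>x = u + v j\<close> these are the coordinates of \<open>u v = X + Y i\<close>, which records the direction in
  which \<open>x\<close> moves the base point. Left multiplication by \<open>\<alpha>\<close> multiplies \<open>u v\<close> by the cube root of
  unity \<open>\<alpha>\<^sup>2\<close>.
\<close>

definition re_uv :: "real quat \<Rightarrow> real" where
  "re_uv x = q1 x * qj x - 3 * (qi x * qij x)"

definition im_uv :: "real quat \<Rightarrow> real" where
  "im_uv x = q1 x * qij x + qi x * qj x"

abbreviation "nrd \<equiv> reduced_norm (-3) (sqrt 2)"
abbreviation qmult (infixl "\<star>" 70) where "qmult \<equiv> quat_mult (-3) (sqrt 2)"

lemma norm_uv:
  assumes "nrd x = 1"
  shows "(re_uv x)\<^sup>2 + 3 * (im_uv x)\<^sup>2 = height x + sqrt 2 * (height x)\<^sup>2"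
proof -
  have "(re_uv x)\<^sup>2 + 3 * (im_uv x)\<^sup>2 = ((q1 x)\<^sup>2 + 3 * (qi x)\<^sup>2) * height x"
    by (simp add: re_uv_def im_uv_def height_def power2_eq_square algebra_simps)
  also have "(q1 x)\<^sup>2 + 3 * (qi x)\<^sup>2 = 1 + sqrt 2 * height x"
    using assms by (simp add: reduced_norm_def height_def algebra_simps)
  finally show ?thesis by (simp add: power2_eq_square algebra_simps)
qed

lemma rotation:
  "height (\<alpha> \<star> x) = height x"
  "re_uv (\<alpha> \<star> x) = (- re_uv x - 3 * im_uv x) / 2" "im_uv (\<alpha> \<star> x) = (re_uv x - im_uv x) / 2"
  by (simp_all add: height_def re_uv_def im_uv_def quat_mult_def \<alpha>_def power2_eq_square field_simps)

lemma nrd_mult: "nrd (x \<star> y) = nrd x * nrd y"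
  by (rule reduced_norm_mult)

lemma nrd_gens: "nrd \<alpha> = 1" "nrd \<beta> = 1" "nrd (quat_cnj \<beta>) = 1"
  by (simp_all add: \<alpha>_def \<beta>_def quat_cnj_def reduced_norm_def power2_eq_square field_simps)

text \<open>
  The constant 1 is the norm of \<open>x\<close>; with it in place, the identities hold for all quaternions.
\<close>

lemma height_beta:
  assumes "nrd x = 1"
  shows "3 * height (\<beta> \<star> x) = 3 * height x + 1 + 2 * sqrt 2 * height x - (1 + 2 * sqrt 2) * re_uv x - 3 * im_uv x"
    and "3 * height (quat_cnj \<beta> \<star> x) = 3 * height x + 1 + 2 * sqrt 2 * height x - (1 + 2 * sqrt 2) * re_uv x + 3 * im_uv x"
proof -
  have s: "sqrt 2 * (sqrt 2 * x) = 2 * x" for x :: real by (simp add: mult.assoc[symmetric])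
  define N where "N = (q1 x)\<^sup>2 + 3 * (qi x)\<^sup>2 - sqrt 2 * height x"
  have N: "N = 1"
    using assms by (simp add: N_def reduced_norm_def height_def algebra_simps)
  have "3 * height (\<beta> \<star> x) = 3 * height x + N + 2 * sqrt 2 * height x - (1 + 2 * sqrt 2) * re_uv x - 3 * im_uv x"
    by (simp add: N_def height_def re_uv_def im_uv_def quat_mult_def \<beta>_def power2_eq_square field_simps s)
  then show "3 * height (\<beta> \<star> x) = 3 * height x + 1 + 2 * sqrt 2 * height x - (1 + 2 * sqrt 2) * re_uv x - 3 * im_uv x"
    by (simp add: N)
  have "3 * height (quat_cnj \<beta> \<star> x) = 3 * height x + N + 2 * sqrt 2 * height x - (1 + 2 * sqrt 2) * re_uv x + 3 * im_uv x"
    by (simp add: N_def height_def re_uv_def im_uv_def quat_mult_def \<beta>_def quat_cnj_def power2_eq_square field_simps s)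
  then show "3 * height (quat_cnj \<beta> \<star> x) = 3 * height x + 1 + 2 * sqrt 2 * height x - (1 + 2 * sqrt 2) * re_uv x + 3 * im_uv x"
    by (simp add: N)
qed

text \<open>
  Squaring gives a comparison of \<open>11 (X\<^sup>2 + 3 Y\<^sup>2) = 11 (V + sqrt 2 V\<^sup>2)\<close> with both sides. The constant
  11 fits: at the edge \<open>X = Y\<close> of the sector the right side squared is \<open>(11.65...) (X\<^sup>2 + 3 Y\<^sup>2)\<close>, its least
  ratio, and for \<open>V \<ge> 1/3\<close> the left side squared is below \<open>11 (V + sqrt 2 V\<^sup>2)\<close>.
\<close>

lemma sector_estimate:
  fixes X Y V :: real
  assumes V: "1/3 \<le> V" and XY: "X\<^sup>2 + 3 * Y\<^sup>2 = V + sqrt 2 * V\<^sup>2" and "0 \<le> Y" "Y \<le> X"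
  shows "1 + 2 * sqrt 2 * V + 1/4 \<le> (1 + 2 * sqrt 2) * X + 3 * Y"
proof (rule power2_le_imp_le)
  let ?s = "sqrt 2"
  have s: "?s * (?s * x) = 2 * x" for x :: real by (simp add: mult.assoc[symmetric])
  note b = sqrt_2_bounds
  have "Y\<^sup>2 \<le> X\<^sup>2" "Y\<^sup>2 \<le> X * Y"
    using assms by (auto simp: power2_eq_square mult_mono mult_right_mono)
  then have "(4 * ?s - 2) * Y\<^sup>2 + 6 * (1 + 2 * ?s) * Y\<^sup>2 \<le> (4 * ?s - 2) * X\<^sup>2 + 6 * (1 + 2 * ?s) * (X * Y)"
    using b by (intro add_mono mult_left_mono) auto
  moreover have "0 \<le> (16 * ?s - 20) * Y\<^sup>2" using b by (intro mult_nonneg_nonneg) auto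
  ultimately have "11 * (X\<^sup>2 + 3 * Y\<^sup>2) \<le> ((1 + 2 * ?s) * X + 3 * Y)\<^sup>2"
    by (simp add: power2_eq_square algebra_simps s)
  moreover have "(1 + 2 * ?s * V + 1/4)\<^sup>2 \<le> 11 * (V + ?s * V\<^sup>2)"
  proof -
    have "1/9 \<le> V\<^sup>2" using mult_mono[OF V V] V by (simp add: power2_eq_square)
    then have "7 * (1/9) \<le> (11 * ?s - 8) * V\<^sup>2" using b by (intro mult_mono) auto
    moreover have "3 * (1/3) \<le> (11 - 5 * ?s) * V" using b V by (intro mult_mono) auto
    ultimately show ?thesis by (simp add: power2_eq_square algebra_simps s)
  qed
  ultimately show "(1 + 2 * ?s * V + 1/4)\<^sup>2 \<le> ((1 + 2 * ?s) * X + 3 * Y)\<^sup>2" using XY by simp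
  show "0 \<le> (1 + 2 * ?s) * X + 3 * Y" using assms by auto
qed

lemma descent_in_sector:
  assumes "nrd x = 1" "1/3 \<le> height x" "\<bar>im_uv x\<bar> \<le> re_uv x"
  shows "height (\<beta> \<star> x) \<le> height x - 1/12 \<or> height (quat_cnj \<beta> \<star> x) \<le> height x - 1/12"
  using sector_estimate[OF assms(2), of "re_uv x" "\<bar>im_uv x\<bar>"] norm_uv[OF assms(1)]
    height_beta[OF assms(1)] assms(3) by (cases "im_uv x \<ge> 0") auto

text \<open>
  The sector \<open>\<bar>Y\<bar> \<le> X\<close> has angle \<open>2\<pi>/3\<close> in the metric \<open>X\<^sup>2 + 3 Y\<^sup>2\<close>, so its three rotations by
  cube roots of unity cover the plane.
\<close>

lemma rotate_to_sector:
  "\<exists>y \<in> {x, \<alpha> \<star> x, \<alpha> \<star> (\<alpha> \<star> x)}. \<bar>im_uv y\<bar> \<le> re_uv y"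
proof -
  have twice: "re_uv (\<alpha> \<star> (\<alpha> \<star> x)) = (3 * im_uv x - re_uv x) / 2"
    "im_uv (\<alpha> \<star> (\<alpha> \<star> x)) = - (re_uv x + im_uv x) / 2"
    by (simp_all add: rotation field_simps)
  consider "\<bar>im_uv x\<bar> \<le> re_uv x" | "re_uv x \<le> - im_uv x" "im_uv x \<le> 0"
    | "re_uv x \<le> im_uv x" "0 \<le> im_uv x" by linarith
  then show ?thesis
  proof cases
    case 2
    then have "\<bar>im_uv (\<alpha> \<star> x)\<bar> \<le> re_uv (\<alpha> \<star> x)"
      unfolding rotation by (auto simp: abs_le_iff)
    then show ?thesis by blast
  next
    case 3
    then have "\<bar>im_uv (\<alpha> \<star> (\<alpha> \<star> x))\<bar> \<le> re_uv (\<alpha> \<star> (\<alpha> \<star> x))"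
      unfolding twice by (auto simp: abs_le_iff)
    then show ?thesis by blast
  qed blast
qed

text \<open>
  Geometrically: a point farther from the base point than the vertices of its Dirichlet hexagon
  is moved closer by one of the six side pairings, which are \<open>\<beta>\<close> and its inverse preceded by powers
  of the rotation \<open>\<alpha>\<close>.
\<close>

lemma descent:
  assumes "nrd x = 1" "1/3 \<le> height x"
  shows "\<exists>g \<in> {\<beta>, quat_cnj \<beta>}. \<exists>y \<in> {x, \<alpha> \<star> x, \<alpha> \<star> (\<alpha> \<star> x)}. height (g \<star> y) \<le> height x - 1/12"
proof -
  obtain y where y: "y \<in> {x, \<alpha> \<star> x, \<alpha> \<star> (\<alpha> \<star> x)}" "\<bar>im_uv y\<bar> \<le> re_uv y"
    using rotate_to_sector by blast
  have "height y = height x" "nrd y = 1"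
    using y(1) assms(1) by (auto simp: rotation nrd_mult nrd_gens)
  then show ?thesis using descent_in_sector[of y] y assms(2) by auto
qed

lemma Q_B1_simps: "x \<in> carrier Q_B1 \<longleftrightarrow> x \<in> Q_B \<and> nrd x = 1"
   "x \<otimes>\<^bsub>Q_B1\<^esub> y = x \<star> y" "\<one>\<^bsub>Q_B1\<^esub> = quat_of 1"
  by (simp_all add: Q_B1_def D_B_def quaternion_algebra_def)

lemma generators_in_Q_B1: "\<alpha> \<in> carrier Q_B1" "\<beta> \<in> carrier Q_B1"
  by (auto simp: Q_B1_simps nrd_gens Q_B_def intro: generate_ring.incl)

lemma inv_Q_B1: "x \<in> carrier Q_B1 \<Longrightarrow> inv\<^bsub>Q_B1\<^esub> x = quat_cnj x"
proof -
  interpret group Q_B1 by (rule Q_B1_group)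
  assume x: "x \<in> carrier Q_B1"
  then have "quat_cnj x \<in> carrier Q_B1"
    using Q_B_cnj by (auto simp: Q_B1_simps reduced_norm_def quat_cnj_def)
  then show ?thesis
    using x by (intro inv_equality) (auto simp: Q_B1_simps quat_mult_cnj)
qed

text \<open>
  Descent on the height: twelve times the height is nonnegative and drops by at least 1 in every
  step, until the height is below \<open>1/3\<close> and the element is a power of \<open>\<alpha>\<close>.
\<close>

lemma Q_B1_generated: "carrier Q_B1 = generate Q_B1 {\<alpha>, \<beta>}"
proof
  interpret group Q_B1 by (rule Q_B1_group)
  let ?H = "generate Q_B1 {\<alpha>, \<beta>}"
  have S: "{\<alpha>, \<beta>} \<subseteq> carrier Q_B1" using generators_in_Q_B1 by simp
  interpret H: subgroup ?H Q_B1 by (rule generate_is_subgroup[OF S])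
  show "?H \<subseteq> carrier Q_B1" by (rule H.subset)
  have gens: "\<alpha> \<in> ?H" "\<beta> \<in> ?H" "quat_cnj \<beta> \<in> ?H"
    using inv_Q_B1[OF generators_in_Q_B1(2)] H.m_inv_closed[of \<beta>] by (auto intro: generate.incl)
  have mult: "x \<star> y \<in> ?H" if "x \<in> ?H" "y \<in> ?H" for x y
    using H.m_closed[OF that] by (simp add: Q_B1_simps)
  have cancel: "x \<in> ?H" if "g \<star> x \<in> ?H" "g \<in> ?H" "x \<in> carrier Q_B1" for g x
    using H.m_closed[OF H.m_inv_closed[OF that(2)] that(1)] that H.subset
    by (simp add: Q_B1_simps(2)[symmetric] m_assoc[symmetric] subset_iff)
  have units: "span_elem 1 0 0 0 \<in> ?H" "span_elem (-1) 0 0 0 \<in> ?H" "span_elem 0 1 0 0 \<in> ?H"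
    "span_elem 0 (-1) 0 0 \<in> ?H" "span_elem 1 (-1) 0 0 \<in> ?H" "span_elem (-1) 1 0 0 \<in> ?H"
  proof -
    have a: "\<alpha> = span_elem 0 1 0 0" by (simp add: \<alpha>_def span_elem_def)
    then show 1: "span_elem 0 1 0 0 \<in> ?H" using gens by simp
    show 2: "span_elem (-1) 1 0 0 \<in> ?H" using mult[OF 1 1] by (simp add: span_elem_mult)
    show 3: "span_elem (-1) 0 0 0 \<in> ?H" using mult[OF 1 2] by (simp add: span_elem_mult)
    show "span_elem 0 (-1) 0 0 \<in> ?H" using mult[OF 3 1] by (simp add: span_elem_mult)
    show "span_elem 1 (-1) 0 0 \<in> ?H" using mult[OF 3 2] by (simp add: span_elem_mult)
    show "span_elem 1 0 0 0 \<in> ?H" using mult[OF 3 3] by (simp add: span_elem_mult)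
  qed
  have "x \<in> ?H" if "x \<in> carrier Q_B1" for x
    using that
  proof (induction "nat \<lfloor>12 * height x\<rfloor>" arbitrary: x rule: less_induct)
    case less
    then have x: "x \<in> Q_B" "nrd x = 1" by (simp_all add: Q_B1_simps)
    show ?case
    proof (cases "height x < 1/3")
      case True
      then show ?thesis using height_zero_cases[OF x] units by auto
    next
      case False
      then obtain g y where g: "g \<in> {\<beta>, quat_cnj \<beta>}"
        and y: "y \<in> {x, \<alpha> \<star> x, \<alpha> \<star> (\<alpha> \<star> x)}"
        and le: "height (g \<star> y) \<le> height x - 1/12"
        using descent[OF x(2)] by force
      have gH: "g \<in> ?H" using g gens by auto
      have c: "v \<star> w \<in> carrier Q_B1" if "v \<in> ?H" "w \<in> carrier Q_B1" for v w
        using m_closed[of v w] that H.subset by (auto simp: Q_B1_simps(2))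
      have yc: "y \<in> carrier Q_B1" using y less.prems c gens by auto
      have "0 \<le> height (g \<star> y)" by (simp add: height_def)
      then have "nat \<lfloor>12 * height (g \<star> y)\<rfloor> < nat \<lfloor>12 * height x\<rfloor>"
        using le by linarith
      then have "g \<star> y \<in> ?H" using less.hyps c[OF gH yc] by blast
      then have "y \<in> ?H" using cancel gH yc by blast
      then show ?thesis using y cancel gens less.prems c by blast
    qed
  qed
  then show "carrier Q_B1 \<subseteq> ?H" by blast
qed

section \<open>The prime ideal above the square root of 2\<close>

lemma Q_B_closed:
  "x \<in> Q_B \<Longrightarrow> y \<in> Q_B \<Longrightarrow> quat_add x y \<in> Q_B"
  "x \<in> Q_B \<Longrightarrow> y \<in> Q_B \<Longrightarrow> x \<star> y \<in> Q_B"
  "c \<in> O_K \<Longrightarrow> quat_of c \<in> Q_B"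
  using subringE(6,7)[OF Q_B_subring]
  by (auto simp: D_B_def quaternion_algebra_def) (auto simp: Q_B_def intro: generate_ring.incl)

lemma span_elem_in_Q_B:
  assumes "p \<in> O_K" "q \<in> O_K" "r \<in> O_K" "s \<in> O_K"
  shows "span_elem p q r s \<in> Q_B"
proof -
  have "span_elem p q r s = quat_add (quat_add (quat_of p) (quat_of q \<star> \<alpha>))
      (quat_add (quat_of r \<star> \<beta>) (quat_of s \<star> (\<alpha> \<star> \<beta>)))"
    by (simp add: span_elem_def quat_add_def quat_of_def quat_mult_def \<alpha>_def \<beta>_def field_simps)
  moreover have "\<alpha> \<in> Q_B" "\<beta> \<in> Q_B" using generators_in_Q_B1 by (simp_all add: Q_B1_simps)
  ultimately show ?thesis using assms by (simp add: Q_B_closed)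
qed

lemma nrd_in_O_K: "x \<in> Q_B \<Longrightarrow> nrd x \<in> O_K"
  by (erule Q_B_span) (simp add: reduced_norm_span_elem norm_form_def O_K_closed)

definition sqrt2_ideal :: "real set" where
  "sqrt2_ideal = (*) (sqrt 2) ` O_K"

lemma sqrt2_ideal_iff: "of_int m + of_int n * sqrt 2 \<in> sqrt2_ideal \<longleftrightarrow> even m"
proof
  assume "of_int m + of_int n * sqrt 2 \<in> sqrt2_ideal"
  then obtain k l :: int where "of_int m + of_int n * sqrt 2 = sqrt 2 * (of_int k + of_int l * sqrt 2)"
    unfolding sqrt2_ideal_def by (elim imageE) (auto simp: O_K_iff)
  also have "\<dots> = of_int (2 * l) + of_int k * sqrt 2" by (simp add: algebra_simps)
  finally show "even m" by (drule_tac sqrt_2_coordinates_unique(1)) simp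
next
  assume "even m"
  then obtain l where "m = 2 * l" by blast
  then have "of_int m + of_int n * sqrt 2 = sqrt 2 * (of_int n + of_int l * sqrt 2)"
    by (simp add: algebra_simps)
  then show "of_int m + of_int n * sqrt 2 \<in> sqrt2_ideal"
    unfolding sqrt2_ideal_def using O_K_I by blast
qed

lemma sqrt2_idealI: "x = sqrt 2 * y \<Longrightarrow> y \<in> O_K \<Longrightarrow> x \<in> sqrt2_ideal"
  by (simp add: sqrt2_ideal_def)

lemma sqrt2_ideal_add: "x \<in> sqrt2_ideal \<Longrightarrow> y \<in> sqrt2_ideal \<Longrightarrow> x + y \<in> sqrt2_ideal"
  unfolding sqrt2_ideal_def by (auto simp: distrib_left[symmetric] intro!: O_K_add imageI)

lemma sqrt2_ideal_mult: "x \<in> sqrt2_ideal \<Longrightarrow> y \<in> O_K \<Longrightarrow> x * y \<in> sqrt2_ideal"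
  unfolding sqrt2_ideal_def by (auto simp: mult.assoc intro!: O_K_mult imageI)

lemma sqrt2_ideal_add_iff: "y \<in> sqrt2_ideal \<Longrightarrow> x + y \<in> sqrt2_ideal \<longleftrightarrow> x \<in> sqrt2_ideal"
  using sqrt2_ideal_add[of x y] sqrt2_ideal_add[of "x + y" "- y"] sqrt2_ideal_mult[of y "- 1"]
  by (auto simp: O_K_uminus)

text \<open>
  Modulo \<open>sqrt 2\<close> the residue field has two elements, over which \<open>x\<^sup>2 + xy + y\<^sup>2\<close> has no nontrivial zero.
\<close>

lemma binary_form_anisotropic:
  assumes "x \<in> O_K" "y \<in> O_K"
  shows "x\<^sup>2 + x * y + y\<^sup>2 \<in> sqrt2_ideal \<longleftrightarrow> x \<in> sqrt2_ideal \<and> y \<in> sqrt2_ideal"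
proof -
  obtain m n k l :: int
    where xy: "x = of_int m + of_int n * sqrt 2" "y = of_int k + of_int l * sqrt 2"
    using assms unfolding O_K_iff by blast
  have "x\<^sup>2 + x * y + y\<^sup>2 = of_int (m\<^sup>2 + m * k + k\<^sup>2 + 2 * (n\<^sup>2 + n * l + l\<^sup>2))
     + of_int (2 * m * n + m * l + n * k + 2 * k * l) * sqrt 2"
    by (simp add: xy power2_eq_square algebra_simps)
  then show ?thesis by (simp only: xy sqrt2_ideal_iff) auto
qed

text \<open>
  The maximal two-sided ideal above \<open>sqrt 2\<close>, the only finite prime at which the algebra ramifies;
  the quotient by it is the field with four elements. Membership by the norm makes stability
  under multiplication immediate, so only addition needs an argument.
\<close>

definition prime_ideal :: "real quat set" where
  "prime_ideal = {x \<in> Q_B. nrd x \<in> sqrt2_ideal}"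

text \<open>
  The two linear forms are the coordinates of the reduction to the field with four elements, which sends
  \<open>\<alpha>\<close> to a primitive cube root of unity \<open>\<omega>\<close> and \<open>\<beta>\<close> to \<open>\<omega>\<^sup>2 = 1 + \<omega>\<close>; modulo \<open>sqrt 2\<close> the reduced norm is the
  norm \<open>x\<^sup>2 + xy + y\<^sup>2\<close> of the image.
\<close>

lemma nrd_sqrt2_ideal_iff:
  assumes "p \<in> O_K" "q \<in> O_K" "r \<in> O_K" "s \<in> O_K"
  shows "nrd (span_elem p q r s) \<in> sqrt2_ideal \<longleftrightarrow> p + r + s \<in> sqrt2_ideal \<and> q + r \<in> sqrt2_ideal"
proof -
  let ?x = "p + r + s" and ?y = "q + r"
  \<comment> \<open>the difference between the reduced norm and that binary form, divided by \<open>sqrt 2\<close>\<close>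
  let ?d = "- (sqrt 2 * r\<^sup>2) - p * s + q * r - sqrt 2 * (p * r + p * s + r * s + q * r)"
  have eq: "nrd (span_elem p q r s) = ?x\<^sup>2 + ?x * ?y + ?y\<^sup>2 + sqrt 2 * ?d"
    unfolding reduced_norm_span_elem norm_form_def by (simp add: power2_eq_square algebra_simps)
  have d: "?d \<in> O_K" by (intro O_K_closed assms O_K_numeral)
  have "sqrt 2 * ?d \<in> sqrt2_ideal" using d by (auto intro!: sqrt2_idealI)
  then have "nrd (span_elem p q r s) \<in> sqrt2_ideal \<longleftrightarrow> ?x\<^sup>2 + ?x * ?y + ?y\<^sup>2 \<in> sqrt2_ideal"
    unfolding eq by (rule sqrt2_ideal_add_iff)
  also have "\<dots> \<longleftrightarrow> ?x \<in> sqrt2_ideal \<and> ?y \<in> sqrt2_ideal"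
    by (intro binary_form_anisotropic O_K_closed assms)
  finally show ?thesis .
qed

lemma prime_ideal_add:
  assumes "x \<in> prime_ideal" "y \<in> prime_ideal"
  shows "quat_add x y \<in> prime_ideal"
proof -
  obtain p q r s where O: "p \<in> O_K" "q \<in> O_K" "r \<in> O_K" "s \<in> O_K" and x: "x = span_elem p q r s"
    using assms(1) unfolding prime_ideal_def by (blast elim: Q_B_span)
  obtain p' q' r' s' where O': "p' \<in> O_K" "q' \<in> O_K" "r' \<in> O_K" "s' \<in> O_K" and y: "y = span_elem p' q' r' s'"
    using assms(2) unfolding prime_ideal_def by (blast elim: Q_B_span)
  have "p + r + s \<in> sqrt2_ideal" "q + r \<in> sqrt2_ideal" "p' + r' + s' \<in> sqrt2_ideal" "q' + r' \<in> sqrt2_ideal"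
    using assms O O' by (auto simp: prime_ideal_def x y nrd_sqrt2_ideal_iff)
  then have "(p + r + s) + (p' + r' + s') \<in> sqrt2_ideal" "(q + r) + (q' + r') \<in> sqrt2_ideal"
    by (blast intro: sqrt2_ideal_add)+
  then have "nrd (quat_add x y) \<in> sqrt2_ideal"
    unfolding x y span_elem_add by (subst nrd_sqrt2_ideal_iff) (auto simp: O O' O_K_add algebra_simps)
  then show ?thesis using assms by (simp add: prime_ideal_def Q_B_closed)
qed

lemma prime_ideal_mult:
  assumes "x \<in> prime_ideal" "y \<in> Q_B"
  shows "x \<star> y \<in> prime_ideal" "y \<star> x \<in> prime_ideal"
  using assms sqrt2_ideal_mult[of "nrd x" "nrd y"]
  by (simp_all add: prime_ideal_def Q_B_closed nrd_mult nrd_in_O_K mult.commute)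

section \<open>The congruence subgroup\<close>

definition one_plus_sqrt2 :: "real quat \<Rightarrow> real quat" where
  "one_plus_sqrt2 x = quat_add (quat_of 1) (quat_of (sqrt 2) \<star> x)"

lemma one_plus_sqrt2_eq:
  "one_plus_sqrt2 x = Quat (1 + sqrt 2 * q1 x) (sqrt 2 * qi x) (sqrt 2 * qj x) (sqrt 2 * qij x)"
  by (simp add: one_plus_sqrt2_def quat_add_def quat_of_def quat_mult_def)

lemma inj_one_plus_sqrt2: "one_plus_sqrt2 x = one_plus_sqrt2 y \<longleftrightarrow> x = y"
  by (cases x; cases y) (simp add: one_plus_sqrt2_eq)

lemma one_plus_sqrt2_mult:
  "one_plus_sqrt2 x \<star> one_plus_sqrt2 y =
     one_plus_sqrt2 (quat_add (quat_add x y) (quat_of (sqrt 2) \<star> (x \<star> y)))"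
  by (simp add: one_plus_sqrt2_eq quat_add_def quat_of_def quat_mult_def algebra_simps)

lemma one_plus_sqrt2_sandwich:
  "x \<star> one_plus_sqrt2 y \<star> z = quat_add (x \<star> z) (quat_of (sqrt 2) \<star> (x \<star> y \<star> z))"
  by (simp add: one_plus_sqrt2_eq quat_add_def quat_of_def quat_mult_def algebra_simps)

lemma one_plus_sqrt2_span_elem:
  "one_plus_sqrt2 (span_elem p q r s) = span_elem (1 + sqrt 2 * p) (sqrt 2 * q) (sqrt 2 * r) (sqrt 2 * s)"
  by (simp add: one_plus_sqrt2_eq span_elem_def algebra_simps)

text \<open>
  The elements of norm 1 congruent to 1 modulo the cube of the prime ideal: the square of that ideal
  is generated by \<open>sqrt 2\<close>. It serves as an upper bound for the preimage of the Bolza group.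
\<close>

definition congruence_subgroup :: "real quat set" where
  "congruence_subgroup = carrier Q_B1 \<inter> one_plus_sqrt2 ` prime_ideal"

lemma congruence_subgroup_normal: "congruence_subgroup \<lhd> Q_B1"
proof -
  interpret group Q_B1 by (rule Q_B1_group)
  let ?M = congruence_subgroup
  have I: "x \<in> ?M" if "x \<in> carrier Q_B1" "x = one_plus_sqrt2 y" "y \<in> prime_ideal" for x y
    using that by (auto simp: congruence_subgroup_def)
  have sub: "subgroup ?M Q_B1"
  proof (rule subgroupI)
    show "?M \<subseteq> carrier Q_B1" by (auto simp: congruence_subgroup_def)
    have "\<one>\<^bsub>Q_B1\<^esub> \<in> ?M"
      by (rule I[of _ "quat_of 0"])
        (simp_all, simp_all add: Q_B1_simps one_plus_sqrt2_eq quat_of_def prime_ideal_def reduced_norm_def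
          Q_B_closed(3)[unfolded quat_of_def] sqrt2_idealI[of _ 0])
    then show "?M \<noteq> {}" by blast
  next
    fix x assume "x \<in> ?M"
    then obtain y where x: "x \<in> carrier Q_B1" "x = one_plus_sqrt2 y" "y \<in> prime_ideal"
      by (auto simp: congruence_subgroup_def)
    show "inv\<^bsub>Q_B1\<^esub> x \<in> ?M"
    proof (rule I[of _ "quat_cnj y"])
      show "inv\<^bsub>Q_B1\<^esub> x = one_plus_sqrt2 (quat_cnj y)"
        using inv_Q_B1[OF x(1)] by (simp add: x(2) one_plus_sqrt2_eq quat_cnj_def)
      show "quat_cnj y \<in> prime_ideal"
        using x(3) Q_B_cnj by (auto simp: prime_ideal_def reduced_norm_def quat_cnj_def)
    qed (use x in simp)
    fix x' assume "x' \<in> ?M"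
    then obtain y' where x': "x' \<in> carrier Q_B1" "x' = one_plus_sqrt2 y'" "y' \<in> prime_ideal"
      by (auto simp: congruence_subgroup_def)
    show "x \<otimes>\<^bsub>Q_B1\<^esub> x' \<in> ?M"
    proof (rule I)
      show "x \<otimes>\<^bsub>Q_B1\<^esub> x' \<in> carrier Q_B1" using x x' by simp
      show "x \<otimes>\<^bsub>Q_B1\<^esub> x' = one_plus_sqrt2 (quat_add (quat_add y y') (quat_of (sqrt 2) \<star> (y \<star> y')))"
        by (simp only: Q_B1_simps x x' one_plus_sqrt2_mult)
      show "quat_add (quat_add y y') (quat_of (sqrt 2) \<star> (y \<star> y')) \<in> prime_ideal"
        using x x' by (intro prime_ideal_add prime_ideal_mult) (auto simp: prime_ideal_def Q_B_closed)
    qed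
  qed
  show ?thesis
  proof (rule normal_invI[OF sub])
    fix x h assume x: "x \<in> carrier Q_B1" and "h \<in> ?M"
    then obtain y where h: "h \<in> carrier Q_B1" "h = one_plus_sqrt2 y" "y \<in> prime_ideal"
      by (auto simp: congruence_subgroup_def)
    have "x \<star> quat_cnj x = quat_of 1" using x by (simp add: Q_B1_simps quat_mult_cnj)
    then have "x \<otimes>\<^bsub>Q_B1\<^esub> h \<otimes>\<^bsub>Q_B1\<^esub> inv\<^bsub>Q_B1\<^esub> x = one_plus_sqrt2 (x \<star> y \<star> quat_cnj x)"
      unfolding inv_Q_B1[OF x] Q_B1_simps h(2) one_plus_sqrt2_sandwich by (simp add: one_plus_sqrt2_def)
    moreover have "x \<star> y \<star> quat_cnj x \<in> prime_ideal"
      using x h(3) Q_B_cnj by (intro prime_ideal_mult) (auto simp: Q_B1_simps)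
    moreover have "x \<otimes>\<^bsub>Q_B1\<^esub> h \<otimes>\<^bsub>Q_B1\<^esub> inv\<^bsub>Q_B1\<^esub> x \<in> carrier Q_B1"
      using x h(1) by simp
    ultimately show "x \<otimes>\<^bsub>Q_B1\<^esub> h \<otimes>\<^bsub>Q_B1\<^esub> inv\<^bsub>Q_B1\<^esub> x \<in> ?M"
      by (blast intro: I)
  qed
qed

lemma span_generators: "\<alpha> = span_elem 0 1 0 0" "\<beta> = span_elem 0 0 1 0"
  by (simp_all add: \<alpha>_def \<beta>_def span_elem_def)

lemma quat_of_span: "quat_of c = span_elem c 0 0 0"
  by (simp add: quat_of_def span_elem_def)

lemma bolza_word_eq: "bolza_word = \<alpha> \<star> \<beta> \<star> (\<alpha> \<star> \<beta>) \<star> (\<alpha> \<star> \<alpha> \<star> (\<beta> \<star> \<beta>) \<star> (\<alpha> \<star> \<alpha> \<star> (\<beta> \<star> \<beta>)))"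
proof -
  interpret R: ring D_B by (rule D_B_ring)
  have sq: "x [^]\<^bsub>D_B\<^esub> (2::nat) = x \<star> x" if "x \<in> carrier D_B" for x
    using that by (simp add: numeral_2_eq_2) (simp add: D_B_def quaternion_algebra_def)
  have m: "x \<otimes>\<^bsub>D_B\<^esub> y = x \<star> y" for x y by (simp add: D_B_def quaternion_algebra_def)
  have c: "\<alpha> \<in> carrier D_B" "\<beta> \<in> carrier D_B" using gens_in_D_B by auto
  have "x \<star> y \<in> carrier D_B" if "x \<in> carrier D_B" "y \<in> carrier D_B" for x y
    using R.m_closed[OF that] by (simp add: m)
  then show ?thesis by (simp add: bolza_word_def m sq c)
qed

lemma bolza_word_span: "bolza_word = span_elem (1 + sqrt 2) (2 + sqrt 2) (- sqrt 2 - 2) 0"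
  unfolding bolza_word_eq span_generators span_elem_mult by (simp add: span_elem_def field_simps)

lemma bolza_word_in_congruence_subgroup: "bolza_word \<in> congruence_subgroup"
proof -
  let ?y = "span_elem 1 (1 + sqrt 2) (- 1 - sqrt 2) 0"
  have "bolza_word = one_plus_sqrt2 ?y"
    by (simp add: bolza_word_span one_plus_sqrt2_span_elem algebra_simps)
  moreover have "nrd ?y = sqrt 2 * (-1)"
    by (simp add: reduced_norm_span_elem norm_form_def power2_eq_square algebra_simps)
  then have "nrd ?y \<in> sqrt2_ideal" by (rule sqrt2_idealI) (intro O_K_closed O_K_numeral)
  then have "?y \<in> prime_ideal"
    by (simp add: prime_ideal_def span_elem_in_Q_B O_K_closed)
  ultimately show ?thesis using bolza_word_in_Q_B1 by (simp add: congruence_subgroup_def)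
qed

lemma pm1_subset_congruence_subgroup: "pm1 \<subseteq> congruence_subgroup"
proof -
  interpret M: normal congruence_subgroup Q_B1 by (rule congruence_subgroup_normal)
  let ?y = "span_elem (- sqrt 2) 0 0 0"
  have "quat_of (-1) = one_plus_sqrt2 ?y"
    by (simp add: quat_of_span one_plus_sqrt2_span_elem)
  moreover have "nrd ?y = sqrt 2 * sqrt 2"
    by (simp add: reduced_norm_span_elem norm_form_def)
  then have "nrd ?y \<in> sqrt2_ideal" by (rule sqrt2_idealI) simp
  then have "?y \<in> prime_ideal"
    by (simp add: prime_ideal_def span_elem_in_Q_B O_K_uminus)
  moreover have "quat_of (-1) \<in> carrier Q_B1"
    by (simp add: Q_B1_simps Q_B_closed O_K_uminus) (simp add: quat_of_def reduced_norm_def)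
  ultimately have "quat_of (-1) \<in> congruence_subgroup" by (simp add: congruence_subgroup_def)
  moreover have "quat_of 1 \<in> congruence_subgroup"
    using subgroup.one_closed[OF M.subgroup_axioms] by (simp add: Q_B1_simps)
  ultimately show ?thesis by (simp add: pm1_def)
qed

text \<open>
  Since \<open>\<alpha>\<beta>\<close> has norm 1 and trace \<open>- sqrt 2\<close>, its square is \<open>1 + sqrt 2 y\<close> with \<open>y = - sqrt 2 - \<alpha>\<beta>\<close>, and
  this \<open>y\<close> has norm 1, a unit modulo \<open>sqrt 2\<close>.
\<close>

lemma alpha_beta_squared_not_in_congruence_subgroup:
  "\<alpha> \<star> \<beta> \<star> (\<alpha> \<star> \<beta>) \<notin> congruence_subgroup"
proof
  let ?y = "span_elem (- sqrt 2) 0 0 (-1)"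
  assume "\<alpha> \<star> \<beta> \<star> (\<alpha> \<star> \<beta>) \<in> congruence_subgroup"
  moreover have "\<alpha> \<star> \<beta> \<star> (\<alpha> \<star> \<beta>) = one_plus_sqrt2 ?y"
    by (simp add: span_generators span_elem_mult one_plus_sqrt2_span_elem)
  ultimately have "?y \<in> prime_ideal"
    by (auto simp: congruence_subgroup_def inj_one_plus_sqrt2)
  moreover have "nrd ?y = 1" by (simp add: reduced_norm_span_elem norm_form_def)
  ultimately show False using sqrt2_ideal_iff[of 1 0] by (simp add: prime_ideal_def)
qed

section \<open>The symmetry group of the Bolza group\<close>

definition to_Sym :: "real quat \<Rightarrow> real quat set set" where
  "to_Sym x = bolza_group #>\<^bsub>Q_B1 Mod pm1\<^esub> (pm1 #>\<^bsub>Q_B1\<^esub> x)"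

lemma to_Sym_hom: "group_hom Q_B1 (Sym_334 bolza_group) to_Sym"
  and to_Sym_surj: "to_Sym ` carrier Q_B1 = carrier (Sym_334 bolza_group)"
proof -
  interpret P: normal pm1 Q_B1 by (rule pm1_normal)
  interpret B: normal bolza_group "Q_B1 Mod pm1" by (rule bolza_group_normal)
  have "to_Sym = (\<lambda>X. bolza_group #>\<^bsub>Q_B1 Mod pm1\<^esub> X) \<circ> (\<lambda>x. pm1 #>\<^bsub>Q_B1\<^esub> x)"
    by (auto simp: to_Sym_def)
  then have "to_Sym \<in> hom Q_B1 (Sym_334 bolza_group)"
    unfolding Sym_334_def using Group.hom_compose[OF P.r_coset_hom_Mod B.r_coset_hom_Mod] by simp
  then show "group_hom Q_B1 (Sym_334 bolza_group) to_Sym"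
    unfolding Sym_334_def group_hom_def group_hom_axioms_def
    using P.group_axioms B.factorgroup_is_group by simp
  show "to_Sym ` carrier Q_B1 = carrier (Sym_334 bolza_group)"
    by (auto simp: Sym_334_def to_Sym_def FactGroup_def RCOSETS_def)
qed

lemma to_Sym_eq_one_iff:
  assumes "x \<in> carrier Q_B1"
  shows "to_Sym x = \<one>\<^bsub>Sym_334 bolza_group\<^esub> \<longleftrightarrow> pm1 #>\<^bsub>Q_B1\<^esub> x \<in> bolza_group"
proof -
  interpret B: normal bolza_group "Q_B1 Mod pm1" by (rule bolza_group_normal)
  have x: "pm1 #>\<^bsub>Q_B1\<^esub> x \<in> carrier (Q_B1 Mod pm1)"
    using assms by (auto simp: FactGroup_def RCOSETS_def)
  show ?thesis
    unfolding to_Sym_def Sym_334_def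
    using B.coset_join1[of bolza_group] B.coset_join2[OF x B.subgroup_axioms] x B.subgroup_axioms B.subset
    by (auto simp: FactGroup_def)
qed

text \<open>
  The congruence subgroup is normal and contains both \<open>-1\<close> and the Bolza word, so its image in
  the quotient by \<open>{1, -1}\<close> contains the normal closure of the word.
\<close>

lemma kernel_to_Sym: "x \<in> carrier Q_B1 \<Longrightarrow> to_Sym x = \<one>\<^bsub>Sym_334 bolza_group\<^esub> \<Longrightarrow> x \<in> congruence_subgroup"
proof -
  assume x: "x \<in> carrier Q_B1" and one: "to_Sym x = \<one>\<^bsub>Sym_334 bolza_group\<^esub>"
  let ?q = "\<lambda>x. pm1 #>\<^bsub>Q_B1\<^esub> x"
  let ?M = congruence_subgroup
  interpret P: normal pm1 Q_B1 by (rule pm1_normal)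
  interpret M: normal ?M Q_B1 by (rule congruence_subgroup_normal)
  interpret F: group "Q_B1 Mod pm1" by (rule P.factorgroup_is_group)
  interpret q: group_hom Q_B1 "Q_B1 Mod pm1" ?q
    by (intro group_hom.intro group_hom_axioms.intro P.r_coset_hom_Mod) (rule P.group_axioms, rule F.group_axioms)
  have "?q ` ?M \<lhd> Q_B1 Mod pm1"
  proof (rule F.normal_invI)
    show "subgroup (?q ` ?M) (Q_B1 Mod pm1)" by (rule q.subgroup_img_is_subgroup[OF M.subgroup_axioms])
    fix X H assume "X \<in> carrier (Q_B1 Mod pm1)" and "H \<in> ?q ` ?M"
    then obtain y m where X: "X = ?q y" "y \<in> carrier Q_B1" and H: "H = ?q m" "m \<in> ?M"
      by (auto simp: FactGroup_def RCOSETS_def)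
    have "X \<otimes>\<^bsub>Q_B1 Mod pm1\<^esub> H \<otimes>\<^bsub>Q_B1 Mod pm1\<^esub> inv\<^bsub>Q_B1 Mod pm1\<^esub> X = ?q (y \<otimes>\<^bsub>Q_B1\<^esub> m \<otimes>\<^bsub>Q_B1\<^esub> inv\<^bsub>Q_B1\<^esub> y)"
      using X H M.mem_carrier[OF H(2)] by simp
    then show "X \<otimes>\<^bsub>Q_B1 Mod pm1\<^esub> H \<otimes>\<^bsub>Q_B1 Mod pm1\<^esub> inv\<^bsub>Q_B1 Mod pm1\<^esub> X \<in> ?q ` ?M"
      using M.inv_op_closed2[OF X(2) H(2)] by blast
  qed
  then have "bolza_group \<subseteq> ?q ` ?M"
    unfolding bolza_group_def normal_closure_def using bolza_word_in_congruence_subgroup by blast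
  then obtain m where m: "m \<in> ?M" "?q x = ?q m"
    using one to_Sym_eq_one_iff[OF x] by auto
  have "x \<in> ?q m" using P.rcos_self[OF x P.subgroup_axioms] m(2) by simp
  then obtain e where "e \<in> pm1" "x = e \<otimes>\<^bsub>Q_B1\<^esub> m" by (auto simp: r_coset_def)
  then show "x \<in> ?M" using pm1_subset_congruence_subgroup m(1) by auto
qed

text \<open>
  The elements \<open>\<alpha>\<close>, \<open>\<beta>\<close> and \<open>\<alpha>\<beta>\<close> have traces 1, 1 and \<open>- sqrt 2\<close>, so their powers of exponent 3, 3 and 4
  are \<open>-1\<close>.
\<close>

lemma Sym_bolza_pair: "bolza_pair (Sym_334 bolza_group) (to_Sym \<alpha>) (to_Sym \<beta>)"
proof -
  let ?S = "Sym_334 bolza_group"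
  interpret h: group_hom Q_B1 ?S to_Sym by (rule to_Sym_hom)
  interpret P: normal pm1 Q_B1 by (rule pm1_normal)
  interpret B: normal bolza_group "Q_B1 Mod pm1" by (rule bolza_group_normal)
  note g = generators_in_Q_B1
  have mult: "to_Sym x \<otimes>\<^bsub>?S\<^esub> to_Sym y = to_Sym (x \<star> y)" "x \<star> y \<in> carrier Q_B1"
    if "x \<in> carrier Q_B1" "y \<in> carrier Q_B1" for x y
    using that h.hom_mult[of x y] h.G.m_closed[of x y] by (simp_all add: Q_B1_simps(2))
  have minus_one: "to_Sym (quat_of (-1)) = \<one>\<^bsub>?S\<^esub>"
  proof -
    have m: "quat_of (-1) \<in> pm1" by (simp add: pm1_def)
    then have c: "quat_of (-1) \<in> carrier Q_B1" using P.subset by blast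
    have "pm1 #>\<^bsub>Q_B1\<^esub> quat_of (-1) = pm1"
      by (rule h.G.coset_join2[OF c P.subgroup_axioms m])
    moreover have "pm1 \<in> bolza_group"
      using subgroup.one_closed[OF B.subgroup_axioms] by (simp add: FactGroup_def)
    ultimately show ?thesis using to_Sym_eq_one_iff[OF c] by simp
  qed
  have word: "to_Sym bolza_word = \<one>\<^bsub>?S\<^esub>"
    using to_Sym_eq_one_iff[OF bolza_word_in_Q_B1]
    by (auto simp: bolza_group_def normal_closure_def)
  show ?thesis
  proof (intro bolza_pair.intro bolza_pair_axioms.intro)
    show "group ?S" by (rule h.H.group_axioms)
    show "to_Sym \<alpha> \<in> carrier ?S" "to_Sym \<beta> \<in> carrier ?S" using g by simp_all
    have "\<alpha> \<star> (\<alpha> \<star> \<alpha>) = quat_of (-1)" "\<beta> \<star> (\<beta> \<star> \<beta>) = quat_of (-1)"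
      "\<alpha> \<star> \<beta> \<star> (\<alpha> \<star> \<beta>) \<star> (\<alpha> \<star> \<beta> \<star> (\<alpha> \<star> \<beta>)) = quat_of (-1)"
      by (simp_all add: span_generators span_elem_mult quat_of_span)
    then show "to_Sym \<alpha> \<otimes>\<^bsub>?S\<^esub> (to_Sym \<alpha> \<otimes>\<^bsub>?S\<^esub> to_Sym \<alpha>) = \<one>\<^bsub>?S\<^esub>"
      "to_Sym \<beta> \<otimes>\<^bsub>?S\<^esub> (to_Sym \<beta> \<otimes>\<^bsub>?S\<^esub> to_Sym \<beta>) = \<one>\<^bsub>?S\<^esub>"
      "to_Sym \<alpha> \<otimes>\<^bsub>?S\<^esub> to_Sym \<beta> \<otimes>\<^bsub>?S\<^esub> (to_Sym \<alpha> \<otimes>\<^bsub>?S\<^esub> to_Sym \<beta>) \<otimes>\<^bsub>?S\<^esub>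
        (to_Sym \<alpha> \<otimes>\<^bsub>?S\<^esub> to_Sym \<beta> \<otimes>\<^bsub>?S\<^esub> (to_Sym \<alpha> \<otimes>\<^bsub>?S\<^esub> to_Sym \<beta>)) = \<one>\<^bsub>?S\<^esub>"
      by (simp_all add: mult g minus_one)
    \<comment> \<open>\<open>\<alpha>\<^sup>2 \<beta>\<^sup>2\<close> is the inverse of \<open>\<beta>\<alpha>\<close>, so the word is the quotient of \<open>(\<alpha>\<beta>)\<^sup>2\<close> by \<open>(\<beta>\<alpha>)\<^sup>2\<close>\<close>
    have eq: "bolza_word \<star> (\<beta> \<star> \<alpha> \<star> (\<beta> \<star> \<alpha>)) = \<alpha> \<star> \<beta> \<star> (\<alpha> \<star> \<beta>)"
      by (simp add: bolza_word_span span_generators span_elem_mult algebra_simps)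
    have ba: "\<beta> \<star> \<alpha> \<star> (\<beta> \<star> \<alpha>) \<in> carrier Q_B1" by (intro mult g)
    have "to_Sym (\<alpha> \<star> \<beta> \<star> (\<alpha> \<star> \<beta>)) = to_Sym bolza_word \<otimes>\<^bsub>?S\<^esub> to_Sym (\<beta> \<star> \<alpha> \<star> (\<beta> \<star> \<alpha>))"
      using mult(1)[OF bolza_word_in_Q_B1 ba] by (simp add: eq)
    also have "\<dots> = to_Sym (\<beta> \<star> \<alpha> \<star> (\<beta> \<star> \<alpha>))" using word ba by simp
    finally show "to_Sym \<alpha> \<otimes>\<^bsub>?S\<^esub> to_Sym \<beta> \<otimes>\<^bsub>?S\<^esub> (to_Sym \<alpha> \<otimes>\<^bsub>?S\<^esub> to_Sym \<beta>) =
        to_Sym \<beta> \<otimes>\<^bsub>?S\<^esub> to_Sym \<alpha> \<otimes>\<^bsub>?S\<^esub> (to_Sym \<beta> \<otimes>\<^bsub>?S\<^esub> to_Sym \<alpha>)"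
      by (simp add: mult g)
    have "generate ?S (to_Sym ` {\<alpha>, \<beta>}) = to_Sym ` generate Q_B1 {\<alpha>, \<beta>}"
      using g by (intro h.generate_img) auto
    then show "carrier ?S = generate ?S {to_Sym \<alpha>, to_Sym \<beta>}"
      by (simp add: Q_B1_generated[symmetric] to_Sym_surj)
  qed
qed

theorem corollary13p3:
  shows "Sym_334 bolza_group \<cong> SL2_F3"
proof (rule bolza_pairs_isomorphic [OF Sym_bolza_pair SL2_F3_elementary_pair _ SL2_F3_pair_nontrivial])
  let ?S = "Sym_334 bolza_group"
  interpret h: group_hom Q_B1 ?S to_Sym by (rule to_Sym_hom)
  have mult: "to_Sym x \<otimes>\<^bsub>?S\<^esub> to_Sym y = to_Sym (x \<star> y)" "x \<star> y \<in> carrier Q_B1"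
    if "x \<in> carrier Q_B1" "y \<in> carrier Q_B1" for x y
    using that h.hom_mult[of x y] h.G.m_closed[of x y] by (simp_all add: Q_B1_simps(2))
  have "to_Sym (\<alpha> \<star> \<beta> \<star> (\<alpha> \<star> \<beta>)) \<noteq> \<one>\<^bsub>?S\<^esub>"
    using kernel_to_Sym alpha_beta_squared_not_in_congruence_subgroup mult(2) generators_in_Q_B1 by metis
  then show "to_Sym \<alpha> \<otimes>\<^bsub>?S\<^esub> to_Sym \<beta> \<otimes>\<^bsub>?S\<^esub> (to_Sym \<alpha> \<otimes>\<^bsub>?S\<^esub> to_Sym \<beta>) \<noteq> \<one>\<^bsub>?S\<^esub>"
    by (simp add: mult generators_in_Q_B1)
qed

end
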